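(* Let $J_T$ be an arbitrary period-$T$ Jacobi operator and $\{\lambda_i\}_{i=3}^\infty$ a sequence of complex numbers belonging to $\sigma_{ell}(J_T)$ where any collection $\{\pi,\theta(\lambda_3),\theta(\lambda_4),\dots,\theta(\lambda_n)\}$, $n\ge 3$, is rationally independent, and let $\{\lambda_1,\lambda_2\}\subseteq\sigma_{ell}(J_T)$ where $0<\theta(\lambda_1)<\frac{\pi}{2}<\theta(\lambda_2)<\pi$ and $\theta(\lambda_1)\neq\pi-\theta(\lambda_2)$. Then for any positive sequence $K(n)$ with $K(n)\to\infty$ arbitrarily slowly as $n\to\infty$, there exist a potential $(q_n)_{n\ge 1}$ with $|q_n|\leq\frac{K(n)}{n}$ for all $n$, and non-zero vectors $(u_{n,i})_{n\geq 1}\in l^2(\mathbb{N};\mathbb{R})$, such that $$(J_T+Q)(u_{n,i})_{n\geq 1}=\lambda_i(u_{n,i})_{n\geq 1}$$ for all $i\ge 1$, where $Q$ is the infinite diagonal matrix with entries $(q_n)$.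
   Context: A period-$T$ Jacobi operator $J_T$ ($T\in\mathbb{N}$) is the operator on $l^2(\mathbb{N})$ given by the tridiagonal symmetric matrix with diagonal entries $b_1,b_2,\dots$ and off-diagonal entries $a_1,a_2,\dots$, where $(a_n)$ and $(b_n)$ are $T$-periodic, $a_n,b_n\in\mathbb{R}$ and $a_n>0$; that is, $(J_Tu)_1=b_1u_1+a_1u_2$ and $(J_Tu)_n=a_{n-1}u_{n-1}+b_nu_n+a_nu_{n+1}$ for $n\ge 2$. The transfer matrices are $$B_i(\lambda)=\begin{pmatrix}0&1\\-\frac{a_{i-1}}{a_i}&\frac{\lambda-b_i}{a_i}\end{pmatrix},\quad i\in\{1,\dots,T\},\ a_0:=a_T,$$ and the monodromy matrix is $M(\lambda)=B_T(\lambda)\cdots B_1(\lambda)$. The generalised interior of the essential spectrum is $\sigma_{ell}(J_T)=\{\lambda\in\mathbb{R} : |\operatorname{Tr}M(\lambda)|<2\}$. For $\lambda\in\sigma_{ell}(J_T)$ the eigenvalues of $M(\lambda)$ are $e^{\pm i\theta(\lambda)}$ with $\theta(\lambda)\in(0,\pi)$; $\theta(\lambda)$ is called the quasi-momentum. A finite collection of real numbers is rationally independent if it is linearly independent over $\mathbb{Q}$. A potential is a real sequence $(q_n)_{n\ge 1}$ converging to zero. *)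

theory Defs
  imports "HOL-Analysis.Analysis"
begin

text \<open>
  Sequences indexed by \<open>n \<ge> 1\<close> are functions on \<^typ>\<open>nat\<close>. For the coefficients \<open>a\<close>, \<open>b\<close>, the
  potential \<open>q\<close> and the bound \<open>K\<close> the value at \<open>0\<close> is never used; vectors of
  \<open>l\<^sup>2\<close> are normalised to be \<open>0\<close> at index \<open>0\<close>, so that equality of vectors is equality of functions.
\<close>

definition l2_real :: "(nat \<Rightarrow> real) set" where
  "l2_real = {u. u 0 = 0 \<and> summable (\<lambda>n. (u n)\<^sup>2)}"

definition periodic_coeffs :: "nat \<Rightarrow> (nat \<Rightarrow> real) \<Rightarrow> (nat \<Rightarrow> real) \<Rightarrow> bool" where
  "periodic_coeffs T a b \<longleftrightarrow>
     T \<ge> 1 \<and> (\<forall>n\<ge>1. a (n + T) = a n \<and> b (n + T) = b n \<and> a n > 0)"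

definition jacobi_op :: "(nat \<Rightarrow> real) \<Rightarrow> (nat \<Rightarrow> real) \<Rightarrow> (nat \<Rightarrow> real) \<Rightarrow> (nat \<Rightarrow> real)" where
  "jacobi_op a b u n =
     (if n = 0 then 0
      else if n = 1 then b 1 * u 1 + a 1 * u 2
      else a (n - 1) * u (n - 1) + b n * u n + a n * u (n + 1))"

definition diag_op :: "(nat \<Rightarrow> real) \<Rightarrow> (nat \<Rightarrow> real) \<Rightarrow> (nat \<Rightarrow> real)" where
  "diag_op q u n = q n * u n"

text \<open>The case distinction in the lower left entry is the convention \<open>a\<^sub>0 := a\<^sub>T\<close>.\<close>

definition transfer_matrix ::
    "nat \<Rightarrow> (nat \<Rightarrow> real) \<Rightarrow> (nat \<Rightarrow> real) \<Rightarrow> nat \<Rightarrow> real \<Rightarrow> real^2^2" where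
  "transfer_matrix T a b i x =
     vector [vector [0, 1],
             vector [- ((if i = 1 then a T else a (i - 1)) / a i), (x - b i) / a i]]"

primrec transfer_product ::
    "nat \<Rightarrow> (nat \<Rightarrow> real) \<Rightarrow> (nat \<Rightarrow> real) \<Rightarrow> nat \<Rightarrow> real \<Rightarrow> real^2^2" where
  "transfer_product T a b 0 x = mat 1"
| "transfer_product T a b (Suc k) x =
     transfer_matrix T a b (Suc k) x ** transfer_product T a b k x"

definition monodromy :: "nat \<Rightarrow> (nat \<Rightarrow> real) \<Rightarrow> (nat \<Rightarrow> real) \<Rightarrow> real \<Rightarrow> real^2^2" where
  "monodromy T a b x = transfer_product T a b T x"

definition sigma_ell :: "nat \<Rightarrow> (nat \<Rightarrow> real) \<Rightarrow> (nat \<Rightarrow> real) \<Rightarrow> real set" where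
  "sigma_ell T a b = {x. \<bar>trace (monodromy T a b x)\<bar> < 2}"

definition complex_eigenvalues :: "real^'n^'n \<Rightarrow> complex set" where
  "complex_eigenvalues A =
     {z. \<exists>v. v \<noteq> 0 \<and> map_matrix complex_of_real A *v v = z *s v}"

text \<open>Meaningful for \<open>x \<in> sigma_ell T a b\<close> only; see \<open>quasi_momentum\<close> below.\<close>

definition quasi_momentum :: "nat \<Rightarrow> (nat \<Rightarrow> real) \<Rightarrow> (nat \<Rightarrow> real) \<Rightarrow> real \<Rightarrow> real" where
  "quasi_momentum T a b x =
     (THE t. 0 < t \<and> t < pi \<and>
        complex_eigenvalues (monodromy T a b x) = {exp (\<i> * of_real t), exp (- \<i> * of_real t)})"

text \<open>
  Linear independence over the rationals of a finite family of reals; as usual for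
  families, a repeated entry makes the family dependent.
\<close>

definition rationally_independent :: "real list \<Rightarrow> bool" where
  "rationally_independent xs \<longleftrightarrow>
     distinct xs \<and> module.independent (\<lambda>(r::rat) (x::real). of_rat r * x) (set xs)"


lemma det_transfer_product:
  assumes "periodic_coeffs T a b" and "1 \<le> k"
  shows "det (transfer_product T a b k x) = a T / a k"
  using \<open>1 \<le> k\<close>
proof (induction k rule: dec_induct)
  case base
  show ?case by (simp add: transfer_matrix_def det_2)
next
  case (step n)
  have "a n > 0" using assms(1) step.hyps by (auto simp: periodic_coeffs_def)
  moreover have "det (transfer_matrix T a b (Suc n) x) = a n / a (Suc n)"
    using step.hyps by (simp add: transfer_matrix_def det_2)
  ultimately show ?case using step.IH by (simp add: det_mul)
qed

lemma det_monodromy: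
  assumes "periodic_coeffs T a b"
  shows "det (monodromy T a b x) = 1"
proof -
  have "T \<ge> 1" "a T > 0" using assms by (auto simp: periodic_coeffs_def)
  then show ?thesis using det_transfer_product[OF assms, of T x] by (simp add: monodromy_def)
qed

lemma complex_eigenvalues_2:
  fixes A :: "real^2^2"
  shows "complex_eigenvalues A = {z. z\<^sup>2 - of_real (trace A) * z + of_real (det A) = 0}"
proof -
  have "(\<exists>v. v \<noteq> 0 \<and> map_matrix complex_of_real A *v v = z *s v) \<longleftrightarrow>
        z\<^sup>2 - of_real (trace A) * z + of_real (det A) = 0" for z
  proof -
    define B where "B = map_matrix complex_of_real A - mat z"
    have "(map_matrix complex_of_real A *v v = z *s v) \<longleftrightarrow> B *v v = 0" for v
      by (simp add: B_def vec_eq_iff forall_2 matrix_vector_mult_def sum_2 mat_def algebra_simps)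
    then have "(\<exists>v. v \<noteq> 0 \<and> map_matrix complex_of_real A *v v = z *s v) \<longleftrightarrow> \<not> invertible B"
      using matrix_left_invertible_ker[of B] invertible_left_inverse[of B] by auto
    also have "\<dots> \<longleftrightarrow> det B = 0" by (simp add: invertible_det_nz)
    also have "det B = z\<^sup>2 - of_real (trace A) * z + of_real (det A)"
      by (simp add: B_def det_2 trace_def sum_2 mat_def power2_eq_square algebra_simps)
    finally show ?thesis .
  qed
  then show ?thesis by (simp add: complex_eigenvalues_def)
qed

lemma quasi_momentum:
  assumes "periodic_coeffs T a b" and "x \<in> sigma_ell T a b"
  defines "t \<equiv> quasi_momentum T a b x"
  shows "0 < t" and "t < pi"
    and "complex_eigenvalues (monodromy T a b x) = {exp (\<i> * of_real t), exp (- \<i> * of_real t)}"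
proof -
  define D where "D = trace (monodromy T a b x)"
  define s where "s = arccos (D / 2)"
  let ?P = "\<lambda>t. 0 < t \<and> t < pi \<and>
        complex_eigenvalues (monodromy T a b x) = {exp (\<i> * of_real t), exp (- \<i> * of_real t)}"
  have D: "\<bar>D\<bar> < 2" using assms by (simp add: sigma_ell_def D_def)
  then have s: "0 < s" "s < pi" "cos s = D / 2"
    using arccos_lt_bounded[of "D/2"] by (auto simp: s_def abs_if split: if_splits)
  have ex: "exp (\<i> * of_real r) = cis r" "exp (- \<i> * of_real r) = cis (- r)" for r
    by (simp_all add: cis_conv_exp)
  have fac: "z\<^sup>2 - of_real D * z + 1 = (z - cis s) * (z - cis (- s))" for z
  proof -
    have "cis s + cis (- s) = of_real D" using s(3) by (simp add: complex_eq_iff)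
    moreover have "cis s * cis (- s) = 1" by (simp add: cis_mult)
    moreover have "(z - cis s) * (z - cis (- s)) = z\<^sup>2 - (cis s + cis (- s)) * z + cis s * cis (- s)"
      by (simp only: power2_eq_square algebra_simps)
    ultimately show ?thesis by simp
  qed
  have "complex_eigenvalues (monodromy T a b x) = {cis s, cis (- s)}"
    using fac det_monodromy[OF assms(1)] by (auto simp: complex_eigenvalues_2 D_def)
  then have Ps: "?P s" using s unfolding ex by simp
  have "r = s" if "?P r" for r
  proof -
    have "{cis r, cis (- r)} = {cis s, cis (- s)}" using that Ps unfolding ex by simp
    then have "Re (cis r) = Re (cis s)" by (auto simp: doubleton_eq_iff complex_eq_iff)
    then show ?thesis using that Ps cos_inj_pi[of r s] by simp
  qed
  then have "t = s" unfolding t_def quasi_momentum_def using Ps by (intro the_equality)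
  then have "?P t" using Ps by simp
  then show "0 < t" "t < pi"
    "complex_eigenvalues (monodromy T a b x) = {exp (\<i> * of_real t), exp (- \<i> * of_real t)}"
    by blast+
qed

lemma periodic_bounded:
  fixes f :: "nat \<Rightarrow> real"
  assumes "T \<ge> 1" and "\<forall>n\<ge>1. f (n + T) = f n"
  shows "\<exists>C. \<forall>n. \<bar>f n\<bar> \<le> C"
proof -
  define C where "C = Max ((\<lambda>n. \<bar>f n\<bar>) ` {..T})"
  have "\<bar>f n\<bar> \<le> C" for n
  proof (induction n rule: less_induct)
    case (less n)
    show ?case
    proof (cases "n \<le> T")
      case True
      then show ?thesis unfolding C_def by (intro Max_ge) auto
    next
      case False
      then have "f n = f (n - T)" using assms(2)[rule_format, of "n - T"] by simp
      then show ?thesis using less[of "n - T"] False assms(1) by simp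
    qed
  qed
  then show ?thesis by blast
qed

lemma l2_real_mult:
  assumes "summable (\<lambda>n. (u n)\<^sup>2)" and "\<And>n. \<bar>f n\<bar> \<le> C"
  shows "summable (\<lambda>n. (f n * u n :: real)\<^sup>2)"
proof (rule summable_comparison_test)
  show "summable (\<lambda>n. C\<^sup>2 * (u n)\<^sup>2)" using assms(1) by (rule summable_mult)
  have "(f n)\<^sup>2 \<le> C\<^sup>2" for n using assms(2) by (metis abs_ge_zero abs_le_square_iff abs_of_nonneg order_trans)
  then show "\<exists>N. \<forall>n\<ge>N. norm ((f n * u n)\<^sup>2) \<le> C\<^sup>2 * (u n)\<^sup>2"
    by (auto simp: power_mult_distrib intro!: mult_right_mono)
qed

lemma l2_real_add:
  assumes "summable (\<lambda>n. (u n)\<^sup>2)" and "summable (\<lambda>n. (v n)\<^sup>2)"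
  shows "summable (\<lambda>n. (u n + v n :: real)\<^sup>2)"
proof (rule summable_comparison_test)
  show "summable (\<lambda>n. 2 * (u n)\<^sup>2 + 2 * (v n)\<^sup>2)"
    using assms by (intro summable_add summable_mult)
  have "(u n + v n)\<^sup>2 \<le> 2 * (u n)\<^sup>2 + 2 * (v n)\<^sup>2" for n
    using zero_le_power2[of "u n - v n"] by (simp add: power2_eq_square algebra_simps)
  then show "\<exists>N. \<forall>n\<ge>N. norm ((u n + v n)\<^sup>2) \<le> 2 * (u n)\<^sup>2 + 2 * (v n)\<^sup>2" by auto
qed

lemma jacobi_op_l2_real:
  assumes "periodic_coeffs T a b" and "u \<in> l2_real"
  shows "jacobi_op a b u \<in> l2_real"
proof -
  obtain A B where A: "\<And>n. \<bar>a n\<bar> \<le> A" and B: "\<And>n. \<bar>b n\<bar> \<le> B"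
    using periodic_bounded[of T a] periodic_bounded[of T b] assms(1)
    unfolding periodic_coeffs_def by metis
  have u: "u 0 = 0" "summable (\<lambda>n. (u n)\<^sup>2)" using assms(2) by (auto simp: l2_real_def)
  have Su: "summable (\<lambda>n. (u (Suc n))\<^sup>2)" using u(2) by (subst summable_Suc_iff)
  have SSu: "summable (\<lambda>n. (u (Suc (Suc n)))\<^sup>2)"
    using Su by (subst summable_Suc_iff[of "\<lambda>n. (u (Suc n))\<^sup>2"])
  have eq: "jacobi_op a b u (Suc n) = a n * u n + b (Suc n) * u (Suc n) + a (Suc n) * u (Suc (Suc n))" for n
    using u(1) by (cases n) (auto simp: jacobi_op_def numeral_2_eq_2)
  have "summable (\<lambda>n. (jacobi_op a b u (Suc n))\<^sup>2)"
    unfolding eq by (intro l2_real_add l2_real_mult[OF u(2) A] l2_real_mult[OF Su B] l2_real_mult[OF SSu A])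
  then have "summable (\<lambda>n. (jacobi_op a b u n)\<^sup>2)"
    by (subst (asm) summable_Suc_iff[of "\<lambda>n. (jacobi_op a b u n)\<^sup>2"])
  then show ?thesis by (simp add: l2_real_def jacobi_op_def)
qed

end

theory Submission
  imports Defs "HOL-Real_Asymp.Real_Asymp"
begin

text \<open>
  For an energy \<open>x\<close> in \<open>sigma_ell T a b\<close> the unperturbed recurrence has a complex solution \<open>\<psi>\<close> with
  \<open>\<psi> (n + T) = \<tau> * \<psi> n\<close>, \<open>|\<tau>| = 1\<close>, whose Wronskian \<open>\<omega>\<close> with its conjugate does not vanish. A real solution
  of the perturbed recurrence is \<open>u n = Re (z n * \<psi> n)\<close>, where the amplitude \<open>z\<close> moves only because of the
  potential: \<open>z n - z (n-1) = (\<i> q n / \<omega>) * cnj (\<psi> n) * Re (z (n-1) * \<psi> n)\<close>. Over a block of \<open>l\<close> sites with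
  potential \<open>\<epsilon> d n\<close> the amplitude changes, up to \<open>O(\<epsilon>\<^sup>2)\<close>, from \<open>z\<close> to
  \<open>z + (\<i> \<epsilon> / (2 \<omega>)) * (G z + cnj F * cnj z)\<close> with \<open>F = \<Sum> d n * (\<psi> n)\<^sup>2\<close> and \<open>G = \<Sum> d n * |\<psi> n|\<^sup>2\<close>.
  Once \<open>F\<close> and \<open>G\<close> satisfy \<open>G z + cnj F * cnj z = 2 \<i> \<omega> r z\<close>, the amplitude is multiplied by
  \<open>1 - \<epsilon> r + O(\<epsilon>\<^sup>2)\<close>; for a block that starts at a large \<open>N\<close> and \<open>\<epsilon> = 2 l / (r (N + l))\<close> this is at most
  \<open>N / (N + l)\<close>. So \<open>N * |z N|\<close> does not increase from block to block, \<open>u n\<close> is \<open>O(1 / n)\<close> and hence square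
  summable (\<open>controlled_block\<close>, \<open>contracting_blocks_decay\<close>). The potential is \<open>O(1 / n)\<close> with a constant
  that depends only on which energies are treated. As \<open>K n\<close> tends to infinity, there is room to treat
  more and more of them (\<open>decaying_potential_exists\<close>).

  It remains to prescribe \<open>F\<close> for finitely many energies at once. Moving \<open>d\<close> by one period multiplies every
  \<open>F\<close> by its own \<open>\<tau>\<^sup>2\<close> and leaves every \<open>G\<close> alone, so real polynomials in the shift separate energies with
  different \<open>\<tau>\<^sup>2\<close>. Rational independence makes \<open>\<tau>\<^sup>2\<close> differ, up to conjugation, for all energies with index at
  least 3, and the hypotheses on the first two quasi-momenta do the same for these two. What they leave
  open is that \<open>lam 1\<close> or \<open>lam 2\<close> shares its \<open>\<tau>\<^sup>2\<close> with one later, different energy. Such a pair is separated by using two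
  different sites (\<open>floquet_squares_independent\<close>, \<open>isolating_control\<close>), with one exception:
  \<open>b\<close> is constant and the two energies are symmetric about it.

  In the exceptional case the second energy has the Floquet solution \<open>(-1) ^ n * \<psi> n\<close>, and its amplitude \<open>w\<close>
  follows the rule for \<open>z\<close> with \<open>- \<omega>\<close> in place of \<open>\<omega>\<close>. To first order the same \<open>F\<close> and \<open>G\<close> must shrink both \<open>z\<close>
  and \<open>w\<close>. They start equal, and then one grows when the other shrinks. For \<open>\<zeta> = w / z\<close> off the real and
  imaginary axes, however, a suitable \<open>F\<close> shrinks both at the rate \<open>r\<close> if \<open>G = - 2 \<omega> r * Re \<zeta> / Im \<zeta>\<close>, and then \<open>\<zeta>\<close> is
  stationary to first order. A small kick \<open>q 1 > 0\<close> moves \<open>\<zeta>\<close> into the quadrant \<open>Re \<zeta> > 0\<close>, \<open>\<omega> * Im \<zeta> < 0\<close>,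
  where a positive \<open>G\<close> gives a positive rate, for all such pairs simultaneously (\<open>kick_ratio\<close>). The
  second-order errors of \<open>\<zeta>\<close> have a finite sum, which is small if the blocks begin late enough; so \<open>\<zeta>\<close>
  never leaves a small ball in that quadrant.
\<close>

section \<open>Floquet solutions\<close>

text \<open>
  The convention \<open>a\<^sub>0 := a\<^sub>T\<close>, which makes the recurrence at the site 1 look like all the others.
\<close>

definition weight0 :: "nat \<Rightarrow> (nat \<Rightarrow> real) \<Rightarrow> nat \<Rightarrow> real" where
  "weight0 T a n = (if n = 0 then a T else a n)"

text \<open>
  Floquet (Bloch) solutions with multiplier \<open>\<tau>\<close>. Up to the factor \<open>2 \<i>\<close>, \<open>\<omega>\<close> is the Wronskian of \<open>\<psi>\<close> with its
  conjugate.
\<close>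

definition floquet ::
  "nat \<Rightarrow> (nat \<Rightarrow> real) \<Rightarrow> (nat \<Rightarrow> real) \<Rightarrow> real \<Rightarrow> (nat \<Rightarrow> complex) \<Rightarrow> real \<Rightarrow> complex \<Rightarrow> bool" where
  "floquet T a b x \<psi> \<omega> \<tau> \<longleftrightarrow>
     cmod \<tau> = 1 \<and> \<omega> \<noteq> 0 \<and> (\<forall>n. \<psi> (n + T) = \<tau> * \<psi> n) \<and>
     (\<forall>n. weight0 T a n * Im (cnj (\<psi> n) * \<psi> (Suc n)) = \<omega>) \<and>
     (\<forall>n. of_real (weight0 T a n) * \<psi> n + of_real (b (Suc n)) * \<psi> (Suc n)
          + of_real (a (Suc n)) * \<psi> (Suc (Suc n)) = of_real x * \<psi> (Suc n))"

fun free_solution ::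
  "nat \<Rightarrow> (nat \<Rightarrow> real) \<Rightarrow> (nat \<Rightarrow> real) \<Rightarrow> real \<Rightarrow> complex \<Rightarrow> complex \<Rightarrow> nat \<Rightarrow> complex" where
  "free_solution T a b x p\<^sub>0 p\<^sub>1 0 = p\<^sub>0"
| "free_solution T a b x p\<^sub>0 p\<^sub>1 (Suc 0) = p\<^sub>1"
| "free_solution T a b x p\<^sub>0 p\<^sub>1 (Suc (Suc n)) =
     (of_real (x - b (Suc n)) * free_solution T a b x p\<^sub>0 p\<^sub>1 (Suc n)
       - of_real (weight0 T a n) * free_solution T a b x p\<^sub>0 p\<^sub>1 n) / of_real (a (Suc n))"

lemma weight0_pos:
  assumes "periodic_coeffs T a b"
  shows "weight0 T a n > 0"
  using assms by (auto simp: periodic_coeffs_def weight0_def)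

lemma weight0_shift:
  assumes "periodic_coeffs T a b"
  shows "weight0 T a (n + T) = weight0 T a n"
  using assms by (cases "n = 0") (auto simp: periodic_coeffs_def weight0_def)

lemma transfer_product_free_solution:
  fixes v :: "complex^2" and x :: real
  assumes "periodic_coeffs T a b"
  defines "\<psi> \<equiv> free_solution T a b x (v $ 1) (v $ 2)"
  shows "map_matrix complex_of_real (transfer_product T a b k x) *v v = vector [\<psi> k, \<psi> (Suc k)]"
proof (induction k)
  case 0
  show ?case
    by (simp add: vec_eq_iff forall_2 matrix_vector_mult_def sum_2 mat_def \<psi>_def)
next
  case (Suc k)
  let ?B = "map_matrix complex_of_real (transfer_matrix T a b (Suc k) x)"
  let ?P = "map_matrix complex_of_real (transfer_product T a b k x)"
  have ak: "a (Suc k) \<noteq> 0" using assms(1) by (auto simp: periodic_coeffs_def dest: spec[of _ "Suc k"])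
  have "map_matrix complex_of_real (transfer_product T a b (Suc k) x) *v v = ?B *v (?P *v v)"
    by (simp add: vec_eq_iff forall_2 matrix_vector_mult_def matrix_matrix_mult_def sum_2
        algebra_simps)
  also have "\<dots> = ?B *v vector [\<psi> k, \<psi> (Suc k)]" using Suc by simp
  also have "\<dots> = vector [\<psi> (Suc k), \<psi> (Suc (Suc k))]"
    using ak by (auto simp: vec_eq_iff forall_2 matrix_vector_mult_def sum_2 transfer_matrix_def
        \<psi>_def weight0_def field_simps)
  finally show ?case .
qed

text \<open>
  An eigenvector of the monodromy matrix for \<open>cis \<theta>\<close> provides the values at 0 and 1. Were the Wronskian
  zero, the solution would be a multiple of a real one, and its multiplier would be real.
\<close>

lemma floquet_with_multiplier:
  assumes per: "periodic_coeffs T a b" and x: "x \<in> sigma_ell T a b"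
  defines "\<theta> \<equiv> quasi_momentum T a b x"
  shows "\<exists>\<psi> \<omega>. floquet T a b x \<psi> \<omega> (cis \<theta>)"
proof -
  have th: "0 < \<theta>" "\<theta> < pi" and
    ev: "complex_eigenvalues (monodromy T a b x) = {exp (\<i> * of_real \<theta>), exp (- \<i> * of_real \<theta>)}"
    using quasi_momentum[OF per x] by (auto simp: \<theta>_def)
  define \<tau> where "\<tau> = cis \<theta>"
  have "\<tau> \<in> complex_eigenvalues (monodromy T a b x)"
    unfolding ev by (simp add: \<tau>_def cis_conv_exp)
  then obtain v where v: "v \<noteq> 0"
    and Mv: "map_matrix complex_of_real (monodromy T a b x) *v v = \<tau> *s v"
    by (auto simp: complex_eigenvalues_def)
  define \<psi> where "\<psi> = free_solution T a b x (v $ 1) (v $ 2)"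
  have "vector [\<psi> T, \<psi> (Suc T)] = \<tau> *s v"
    using transfer_product_free_solution[OF per, where x = x and k = T and v = v] Mv by (simp add: monodromy_def \<psi>_def)
  then have T0: "\<psi> T = \<tau> * \<psi> 0" and T1: "\<psi> (Suc T) = \<tau> * \<psi> (Suc 0)"
    by (simp_all add: vec_eq_iff forall_2 \<psi>_def)
  have apos: "a (Suc n) > 0" for n using per by (auto simp: periodic_coeffs_def)
  have rec: "of_real (weight0 T a n) * \<psi> n + of_real (b (Suc n)) * \<psi> (Suc n)
          + of_real (a (Suc n)) * \<psi> (Suc (Suc n)) = of_real x * \<psi> (Suc n)" for n
    using apos[of n] by (simp add: \<psi>_def field_simps)
  have rec': "of_real (a (Suc n)) * \<psi> (Suc (Suc n)) =
      of_real (x - b (Suc n)) * \<psi> (Suc n) - of_real (weight0 T a n) * \<psi> n" for n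
    using rec[of n] by (simp add: algebra_simps)
  have shift: "\<psi> (n + T) = \<tau> * \<psi> n \<and> \<psi> (Suc n + T) = \<tau> * \<psi> (Suc n)" for n
  proof (induction n)
    case 0
    then show ?case using T0 T1 by simp
  next
    case (Suc n)
    have c: "b (Suc n + T) = b (Suc n)" "a (Suc n + T) = a (Suc n)"
      using per by (auto simp: periodic_coeffs_def simp del: add_Suc)
    have "of_real (a (Suc n)) * \<psi> (Suc (Suc n) + T) =
        of_real (x - b (Suc n)) * \<psi> (Suc n + T) - of_real (weight0 T a n) * \<psi> (n + T)"
      using rec'[of "n + T"] weight0_shift[OF per, of n] c by simp
    also have "\<dots> = \<tau> * (of_real (x - b (Suc n)) * \<psi> (Suc n) - of_real (weight0 T a n) * \<psi> n)"
      unfolding conjunct1[OF Suc] conjunct2[OF Suc] by (simp only: right_diff_distrib mult_ac)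
    also have "\<dots> = of_real (a (Suc n)) * (\<tau> * \<psi> (Suc (Suc n)))"
      unfolding rec'[symmetric] by (simp only: mult_ac)
    finally have "of_real (a (Suc n)) * \<psi> (Suc (Suc n) + T) = of_real (a (Suc n)) * (\<tau> * \<psi> (Suc (Suc n)))" .
    then show ?case using Suc apos[of n] by simp
  qed
  define W where "W n = weight0 T a n * Im (cnj (\<psi> n) * \<psi> (Suc n))" for n
  have Wc: "W (Suc n) = W n" for n
  proof -
    have "cnj (\<psi> (Suc n)) * (of_real (a (Suc n)) * \<psi> (Suc (Suc n))) =
        cnj (\<psi> (Suc n)) * (of_real (x - b (Suc n)) * \<psi> (Suc n) - of_real (weight0 T a n) * \<psi> n)"
      by (simp only: rec')
    then have "Im (cnj (\<psi> (Suc n)) * (of_real (a (Suc n)) * \<psi> (Suc (Suc n)))) =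
        Im (cnj (\<psi> (Suc n)) * (of_real (x - b (Suc n)) * \<psi> (Suc n) - of_real (weight0 T a n) * \<psi> n))"
      by (rule arg_cong)
    then show ?thesis by (simp add: W_def weight0_def[of _ _ "Suc n"] algebra_simps)
  qed
  have W: "W n = W 0" for n by (induction n) (simp_all add: Wc)
  have "W 0 \<noteq> 0"
  proof
    assume "W 0 = 0"
    then have par: "Im (cnj (\<psi> 0) * \<psi> (Suc 0)) = 0"
      using weight0_pos[OF per, of 0] by (simp add: W_def)
    \<comment> \<open>Both values lie on one real line, so a constant factor makes the whole sequence real.\<close>
    obtain c where c: "c \<noteq> 0" "Im (c * \<psi> 0) = 0" "Im (c * \<psi> (Suc 0)) = 0"
    proof (cases "\<psi> 0 = 0")
      case True
      then have "\<psi> (Suc 0) \<noteq> 0" using v by (auto simp: \<psi>_def vec_eq_iff forall_2)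
      then show ?thesis using True by (intro that[of "cnj (\<psi> (Suc 0))"]) (auto simp: algebra_simps)
    next
      case False
      then show ?thesis using par by (intro that[of "cnj (\<psi> 0)"]) (auto simp: algebra_simps)
    qed
    have real: "Im (c * \<psi> n) = 0 \<and> Im (c * \<psi> (Suc n)) = 0" for n
    proof (induction n)
      case (Suc n)
      have "of_real (a (Suc n)) * (c * \<psi> (Suc (Suc n))) =
        of_real (x - b (Suc n)) * (c * \<psi> (Suc n)) - of_real (weight0 T a n) * (c * \<psi> n)"
        using arg_cong[OF rec'[of n], of "\<lambda>t. c * t"] by (simp add: algebra_simps)
      then have "Im (of_real (a (Suc n)) * (c * \<psi> (Suc (Suc n)))) =
          Im (of_real (x - b (Suc n)) * (c * \<psi> (Suc n)) - of_real (weight0 T a n) * (c * \<psi> n))"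
        by simp
      also have "\<dots> = 0" using Suc by (simp del: mult.assoc)
      finally have "a (Suc n) * Im (c * \<psi> (Suc (Suc n))) = 0" by simp
      then show ?case using Suc apos[of n] by simp
    qed (use c in auto)
    have "\<psi> 0 \<noteq> 0 \<or> \<psi> (Suc 0) \<noteq> 0" using v by (auto simp: \<psi>_def vec_eq_iff forall_2)
    then obtain m where m: "\<psi> m \<noteq> 0" by blast
    have "c * \<psi> (m + T) = \<tau> * (c * \<psi> m)" using shift[of m] by simp
    then have "Im (\<tau> * (c * \<psi> m)) = 0" using real[of "m + T"] by metis
    then have "Im \<tau> * Re (c * \<psi> m) = 0" using real[of m] by simp
    moreover have "Re (c * \<psi> m) \<noteq> 0" 
    proof
      assume "Re (c * \<psi> m) = 0"
      then have "c * \<psi> m = 0" using real[of m] by (simp only: complex_eq_iff) simp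
      then show False using c(1) m by simp
    qed
    moreover have "Im \<tau> \<noteq> 0" using sin_gt_zero[OF th] by (simp add: \<tau>_def)
    ultimately show False by simp
  qed
  then have "floquet T a b x \<psi> (W 0) \<tau>"
    using shift rec W by (auto simp: floquet_def \<tau>_def W_def)
  then show ?thesis by (auto simp: \<tau>_def)
qed

lemma floquet_cnj:
  assumes "floquet T a b x \<psi> \<omega> \<tau>"
  shows "floquet T a b x (\<lambda>n. cnj (\<psi> n)) (- \<omega>) (cnj \<tau>)"
proof -
  have "of_real (weight0 T a n) * cnj (\<psi> n) + of_real (b (Suc n)) * cnj (\<psi> (Suc n))
          + of_real (a (Suc n)) * cnj (\<psi> (Suc (Suc n))) = of_real x * cnj (\<psi> (Suc n))" for n
    using arg_cong[of _ _ cnj, OF spec[of _ n]] assms unfolding floquet_def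
    by (metis (no_types, lifting) complex_cnj_add complex_cnj_complex_of_real complex_cnj_mult)
  moreover have "weight0 T a n * Im (cnj (cnj (\<psi> n)) * cnj (\<psi> (Suc n))) = - \<omega>" for n
    using assms by (auto simp: floquet_def algebra_simps dest: spec[of _ n])
  ultimately show ?thesis using assms by (auto simp: floquet_def)
qed

text \<open>
  Passing to the conjugate solution if necessary puts \<open>\<tau>\<^sup>2\<close> into the upper half plane. Then \<open>Re (\<tau>\<^sup>2)\<close>
  determines \<open>\<tau>\<^sup>2\<close>, so that a resonance between two energies is an equality of \<open>\<tau>\<^sup>2\<close>, not
  an equality up to conjugation.
\<close>

lemma floquet_exists:
  assumes per: "periodic_coeffs T a b" and x: "x \<in> sigma_ell T a b"
    and "quasi_momentum T a b x \<noteq> pi / 2"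
  shows "\<exists>\<psi> \<omega> \<tau>. floquet T a b x \<psi> \<omega> \<tau> \<and> Im (\<tau>\<^sup>2) > 0 \<and>
           Re (\<tau>\<^sup>2) = cos (2 * quasi_momentum T a b x)"
proof -
  define \<theta> where "\<theta> = quasi_momentum T a b x"
  have th: "0 < \<theta>" "\<theta> < pi" "\<theta> \<noteq> pi / 2" using quasi_momentum[OF per x] assms(3) by (auto simp: \<theta>_def)
  obtain \<psi> \<omega> where fl: "floquet T a b x \<psi> \<omega> (cis \<theta>)"
    using floquet_with_multiplier[OF per x] by (auto simp: \<theta>_def)
  have sq: "(cis \<theta>)\<^sup>2 = cis (2 * \<theta>)" "(cnj (cis \<theta>))\<^sup>2 = cis (- (2 * \<theta>))"
    by (simp_all add: cis_cnj power2_eq_square cis_mult)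
  show ?thesis
  proof (cases "\<theta> < pi / 2")
    case True
    then have "sin (2 * \<theta>) > 0" using th by (intro sin_gt_zero) auto
    then show ?thesis using fl sq(1) unfolding \<theta>_def[symmetric]
      by (intro exI[of _ \<psi>] exI[of _ \<omega>] exI[of _ "cis \<theta>"]) simp
  next
    case False
    then have "sin (2 * \<theta>) < 0" using th by (intro sin_lt_zero) auto
    then show ?thesis using floquet_cnj[OF fl] sq(2) unfolding \<theta>_def[symmetric]
      by (intro exI[of _ "\<lambda>n. cnj (\<psi> n)"] exI[of _ "- \<omega>"] exI[of _ "cnj (cis \<theta>)"]) simp
  qed
qed

lemma floquet_wronskian_nonzero:
  assumes "floquet T a b x \<psi> \<omega> \<tau>"
  shows "Im (cnj (\<psi> n) * \<psi> (Suc n)) \<noteq> 0"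
  using assms by (metis floquet_def mult_zero_right)

lemma floquet_recurrence:
  assumes "floquet T a b x \<psi> \<omega> \<tau>"
  shows "of_real (weight0 T a n) * \<psi> n + of_real (b (Suc n)) * \<psi> (Suc n)
          + of_real (a (Suc n)) * \<psi> (Suc (Suc n)) = of_real x * \<psi> (Suc n)"
  using assms by (simp add: floquet_def)

lemma floquet_nonzero:
  assumes "floquet T a b x \<psi> \<omega> \<tau>"
  shows "\<psi> n \<noteq> 0"
  using floquet_wronskian_nonzero[OF assms, of n] by auto

lemma floquet_bounded:
  fixes T :: nat and \<psi> :: "nat \<Rightarrow> complex"
  assumes "T \<ge> 1" and "cmod \<tau> = 1" and "\<And>n. \<psi> (n + T) = \<tau> * \<psi> n"
  shows "\<exists>B>0. \<forall>n. cmod (\<psi> n) \<le> B"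
proof -
  have "\<exists>C. \<forall>n. \<bar>cmod (\<psi> n)\<bar> \<le> C"
    using assms by (intro periodic_bounded[of T]) (auto simp: norm_mult)
  then obtain C where "\<forall>n. cmod (\<psi> n) \<le> C" by auto
  then have "\<forall>n. cmod (\<psi> n) \<le> max C 1" by (meson max.coboundedI1)
  then show ?thesis by (intro exI[of _ "max C 1"]) auto
qed

text \<open>
  The chiral symmetry: for constant \<open>b\<close>, conjugation by \<open>(-1) ^ n\<close> reflects the operator about \<open>b\<close>.
\<close>

lemma floquet_chiral:
  assumes fl: "floquet T a b x \<psi> \<omega> \<tau>" and b: "\<And>n. n \<ge> 1 \<Longrightarrow> 2 * b n = x + y"
  shows "floquet T a b y (\<lambda>n. (-1) ^ n * \<psi> n) (- \<omega>) ((-1) ^ T * \<tau>)"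
proof -
  have sq: "(-1::complex) ^ n * (-1) ^ n = 1" for n by (simp flip: power_add add: mult_2[symmetric])
  have "of_real (weight0 T a n) * ((-1) ^ n * \<psi> n) + of_real (b (Suc n)) * ((-1) ^ Suc n * \<psi> (Suc n))
      + of_real (a (Suc n)) * ((-1) ^ Suc (Suc n) * \<psi> (Suc (Suc n)))
      = of_real y * ((-1) ^ Suc n * \<psi> (Suc n))" for n
  proof -
    have y: "y = 2 * b (Suc n) - x" using b[of "Suc n"] by simp
    have rec: "of_real (weight0 T a n) * \<psi> n + of_real (b (Suc n)) * \<psi> (Suc n)
          + of_real (a (Suc n)) * \<psi> (Suc (Suc n)) = of_real x * \<psi> (Suc n)"
      using fl by (simp add: floquet_def)
    have "(-1) ^ n * (of_real (weight0 T a n) * \<psi> n + of_real (b (Suc n)) * \<psi> (Suc n)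
          + of_real (a (Suc n)) * \<psi> (Suc (Suc n))) = (-1) ^ n * (of_real x * \<psi> (Suc n))"
      by (simp only: rec)
    then show ?thesis unfolding y by (simp add: algebra_simps)
  qed
  moreover have "weight0 T a n * Im (cnj ((-1) ^ n * \<psi> n) * ((-1) ^ Suc n * \<psi> (Suc n))) = - \<omega>" for n
  proof -
    have "cnj ((-1) ^ n * \<psi> n) * ((-1) ^ Suc n * \<psi> (Suc n)) =
        - (((-1) ^ n * (-1) ^ n) * (cnj (\<psi> n) * \<psi> (Suc n)))"
      by (simp add: mult_ac)
    moreover have "weight0 T a n * Im (cnj (\<psi> n) * \<psi> (Suc n)) = \<omega>" using fl by (simp add: floquet_def)
    ultimately show ?thesis by (simp only: sq mult_1 uminus_complex.sel mult_minus_right)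
  qed
  ultimately show ?thesis using fl
    by (auto simp: floquet_def norm_mult norm_power power_add mult_ac)
qed

text \<open>
  If the squares were proportional, \<open>\<eta> n\<close> would be \<open>c * s n * \<psi> n\<close> with signs \<open>s n\<close>. Compare the two recurrences at
  a site. If the sign changes on exactly one side of it, then neighbouring values of \<open>\<psi>\<close> have a real
  ratio, against the Wronskian; if it changes on neither side, the energies agree. So it changes on both
  sides; adding the recurrences then gives \<open>2 * b n = x + y\<close>, by periodicity at every site.
\<close>

lemma floquet_squares_independent:
  assumes per: "periodic_coeffs T a b"
    and fl: "floquet T a b x \<psi> \<omega> \<tau>" and fl': "floquet T a b y \<eta> \<omega>' \<tau>'"
    and xy: "x \<noteq> y" and nch: "\<not> (\<forall>n\<ge>1. 2 * b n = x + y)"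
  shows "\<exists>m\<ge>1. \<exists>n\<ge>1. (\<psi> m)\<^sup>2 * (\<eta> n)\<^sup>2 \<noteq> (\<psi> n)\<^sup>2 * (\<eta> m)\<^sup>2"
proof (rule ccontr)
  assume "\<not> ?thesis"
  then have sq_eq: "(\<psi> m)\<^sup>2 * (\<eta> n)\<^sup>2 = (\<psi> n)\<^sup>2 * (\<eta> m)\<^sup>2" if "m \<ge> 1" "n \<ge> 1" for m n
    using that by blast
  note nz = floquet_nonzero[OF fl] and nz' = floquet_nonzero[OF fl']
  have apos: "a n > 0" if "n \<ge> 1" for n using per that by (auto simp: periodic_coeffs_def)
  \<comment> \<open>Multiplying the recurrence of \<open>\<eta>\<close> at \<open>n\<close> by \<open>s n / c\<close> leaves the relative signs \<open>S1\<close>, \<open>S2\<close> of the neighbours.\<close>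
  define s where "s n = \<eta> n * \<psi> 1 / (\<psi> n * \<eta> 1)" for n
  have s: "s n = 1 \<or> s n = - 1" if "n \<ge> 1" for n
  proof -
    have "(s n)\<^sup>2 = 1"
      using sq_eq[OF that, of 1] nz nz' by (simp add: s_def power_divide power_mult_distrib mult_ac)
    then show ?thesis by (simp add: power2_eq_1_iff)
  qed
  define c where "c = \<eta> 1 / \<psi> 1"
  have c: "c \<noteq> 0" using nz nz' by (simp add: c_def)
  have chi: "\<eta> n = c * s n * \<psi> n" for n using nz nz' by (simp add: c_def s_def field_simps)
  have b2: "2 * b n = x + y" if "n \<ge> 2" for n
  proof -
    obtain k where k: "n = Suc k" "k \<ge> 1" using \<open>n \<ge> 2\<close> by (cases n) auto
    define A B where "A = a k" and "B = a (Suc k)"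
    have AB: "A > 0" "B > 0" using apos k by (auto simp: A_def B_def)
    have r1: "of_real A * \<psi> k + of_real (b n) * \<psi> n + of_real B * \<psi> (Suc n) = of_real x * \<psi> n"
      using floquet_recurrence[OF fl, of k] k by (simp add: weight0_def A_def B_def)
    have "of_real A * \<eta> k + of_real (b n) * \<eta> n + of_real B * \<eta> (Suc n) = of_real y * \<eta> n"
      using floquet_recurrence[OF fl', of k] k by (simp add: weight0_def A_def B_def)
    then have "c * (of_real A * (s k * \<psi> k) + of_real (b n) * (s n * \<psi> n) + of_real B * (s (Suc n) * \<psi> (Suc n)))
        = c * (of_real y * (s n * \<psi> n))"
      unfolding chi[of k] chi[of n] chi[of "Suc n"] by (simp add: algebra_simps)
    then have r2: "of_real A * (s k * \<psi> k) + of_real (b n) * (s n * \<psi> n) + of_real B * (s (Suc n) * \<psi> (Suc n))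
        = of_real y * (s n * \<psi> n)"
      using c by simp
    have w1: "Im (cnj (\<psi> n) * \<psi> (Suc n)) \<noteq> 0" by (rule floquet_wronskian_nonzero[OF fl])
    have w2: "Im (cnj (\<psi> n) * \<psi> k) \<noteq> 0"
      using floquet_wronskian_nonzero[OF fl, of k] k by (auto simp: algebra_simps)
    have cancel: False if "of_real r * \<psi> m = of_real t * \<psi> n" "r \<noteq> 0" "Im (cnj (\<psi> n) * \<psi> m) \<noteq> 0"
      for r t :: real and m
    proof -
      have "of_real r * (cnj (\<psi> n) * \<psi> m) = of_real t * (cnj (\<psi> n) * \<psi> n)"
        using that(1) by (metis mult.left_commute)
      then have "Im (of_real r * (cnj (\<psi> n) * \<psi> m)) = Im (of_real t * (cnj (\<psi> n) * \<psi> n))"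
        by (rule arg_cong)
      then show False using that(2,3) by (simp add: algebra_simps)
    qed
    define S1 S2 where "S1 = s k * s n" and "S2 = s (Suc n) * s n"
    have ss: "s n * s n = 1" using s[of n] k by auto
    have "s n * (of_real A * (s k * \<psi> k) + of_real (b n) * (s n * \<psi> n) + of_real B * (s (Suc n) * \<psi> (Suc n)))
        = s n * (of_real y * (s n * \<psi> n))"
      by (simp only: r2)
    then have "of_real A * (S1 * \<psi> k) + of_real (b n) * ((s n * s n) * \<psi> n) + of_real B * (S2 * \<psi> (Suc n))
        = of_real y * ((s n * s n) * \<psi> n)"
      by (simp add: S1_def S2_def algebra_simps)
    then have r3: "of_real A * (S1 * \<psi> k) + of_real (b n) * \<psi> n + of_real B * (S2 * \<psi> (Suc n))
        = of_real y * \<psi> n"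
      by (simp add: ss)
    have "S1 = 1 \<or> S1 = - 1" "S2 = 1 \<or> S2 = -1" using s[of k] s[of n] s[of "Suc n"] k by (auto simp: S1_def S2_def)
    then consider "S1 = 1" "S2 = 1" | "S1 = 1" "S2 = - 1" | "S1 = - 1" "S2 = 1" | "S1 = - 1" "S2 = - 1"
      by blast
    then show ?thesis
    proof cases
      case 1
      then have "of_real x * \<psi> n = of_real y * \<psi> n" using r1 r3 by simp
      then show ?thesis using nz xy by simp
    next
      case 2
      have "of_real (2 * B) * \<psi> (Suc n) = (of_real A * \<psi> k + of_real (b n) * \<psi> n + of_real B * \<psi> (Suc n)) - (of_real A * (S1 * \<psi> k) + of_real (b n) * \<psi> n + of_real B * (S2 * \<psi> (Suc n)))"
        by (simp add: 2 algebra_simps)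
      also have "\<dots> = of_real (x - y) * \<psi> n" unfolding r1 r3 by (simp add: algebra_simps)
      finally have e: "of_real (2 * B) * \<psi> (Suc n) = of_real (x - y) * \<psi> n" .
      show ?thesis using cancel[OF e] AB w1 by simp
    next
      case 3
      have "of_real (2 * A) * \<psi> k = (of_real A * \<psi> k + of_real (b n) * \<psi> n + of_real B * \<psi> (Suc n)) - (of_real A * (S1 * \<psi> k) + of_real (b n) * \<psi> n + of_real B * (S2 * \<psi> (Suc n)))"
        by (simp add: 3 algebra_simps)
      also have "\<dots> = of_real (x - y) * \<psi> n" unfolding r1 r3 by (simp add: algebra_simps)
      finally have e: "of_real (2 * A) * \<psi> k = of_real (x - y) * \<psi> n" .
      show ?thesis using cancel[OF e] AB w2 by simp
    next
      case 4
      have "of_real (2 * b n) * \<psi> n = (of_real A * \<psi> k + of_real (b n) * \<psi> n + of_real B * \<psi> (Suc n)) + (of_real A * (S1 * \<psi> k) + of_real (b n) * \<psi> n + of_real B * (S2 * \<psi> (Suc n)))"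
        by (simp add: 4 algebra_simps)
      also have "\<dots> = of_real (x + y) * \<psi> n" unfolding r1 r3 by (simp add: algebra_simps)
      finally have e: "of_real (2 * b n) * \<psi> n = of_real (x + y) * \<psi> n" .
      then have "complex_of_real (2 * b n) = of_real (x + y)" using nz by (simp only: mult_cancel_right) simp
      then show ?thesis by (simp only: of_real_eq_iff)
    qed
  qed
  have "2 * b n = x + y" if "n \<ge> 1" for n
    using b2[of "n + T"] that per by (auto simp: periodic_coeffs_def)
  then show False using nch by blast
qed

section \<open>Solutions of the perturbed equation\<close>

text \<open>
  Variation of constants. The initial value is chosen such that \<open>Re (amplitude \<omega> \<phi> q 0 * \<phi> 0) = 0\<close>, the boundary
  condition of the half-line operator.
\<close>

primrec amplitude ::
  "real \<Rightarrow> (nat \<Rightarrow> complex) \<Rightarrow> (nat \<Rightarrow> real) \<Rightarrow> nat \<Rightarrow> complex" where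
  "amplitude \<omega> \<phi> q 0 = \<i> * cnj (\<phi> 0)"
| "amplitude \<omega> \<phi> q (Suc n) = amplitude \<omega> \<phi> q n +
     \<i> * of_real (q (Suc n) / \<omega> * Re (amplitude \<omega> \<phi> q n * \<phi> (Suc n))) * cnj (\<phi> (Suc n))"

definition perturbed_solution ::
  "real \<Rightarrow> (nat \<Rightarrow> complex) \<Rightarrow> (nat \<Rightarrow> real) \<Rightarrow> nat \<Rightarrow> real" where
  "perturbed_solution \<omega> \<phi> q n = Re (amplitude \<omega> \<phi> q n * \<phi> n)"

lemma amplitude_cong:
  assumes "\<And>n. 1 \<le> n \<Longrightarrow> n \<le> N \<Longrightarrow> q n = q' n"
  shows "amplitude \<omega> \<phi> q N = amplitude \<omega> \<phi> q' N"
  using assms by (induction N) auto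

text \<open>
  Each step is an invertible real linear map of the plane, so ratios of amplitudes are meaningful.
\<close>

lemma amplitude_nonzero:
  assumes "\<phi> 0 \<noteq> 0"
  shows "amplitude \<omega> \<phi> q n \<noteq> 0"
proof (induction n)
  case 0
  then show ?case using assms by simp
next
  case (Suc n)
  let ?z = "amplitude \<omega> \<phi> q n" and ?p = "\<phi> (Suc n)"
  define s where "s = q (Suc n) / \<omega> * Re (?z * ?p)"
  show ?case
  proof
    assume "amplitude \<omega> \<phi> q (Suc n) = 0"
    then have z: "?z = - (\<i> * of_real s * cnj ?p)" by (simp add: s_def add_eq_0_iff2)
    then have "Re (?z * ?p) = 0" by (simp add: algebra_simps)
    then have "s = 0" by (simp add: s_def)
    then show False using z Suc by simp
  qed
qed

text \<open>
  The increment of the amplitude is invisible at the site where it happens. This is why \<open>u (n + 1)\<close> and \<open>u n\<close>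
  are both obtained from the amplitude with index \<open>n\<close>.
\<close>

lemma perturbed_solution_Suc:
  "Re (amplitude \<omega> \<phi> q n * \<phi> (Suc n)) = perturbed_solution \<omega> \<phi> q (Suc n)"
  by (simp add: perturbed_solution_def algebra_simps)

lemma perturbed_solution_recurrence:
  fixes q :: "nat \<Rightarrow> real"
  assumes per: "periodic_coeffs T a b" and fl: "floquet T a b x \<psi> \<omega> \<tau>"
  defines "u \<equiv> perturbed_solution \<omega> \<psi> q"
  shows "weight0 T a n * u n + (b (Suc n) + q (Suc n)) * u (Suc n) + a (Suc n) * u (Suc (Suc n))
           = x * u (Suc n)"
proof -
  let ?z = "amplitude \<omega> \<psi> q"
  have om: "\<omega> \<noteq> 0" using fl by (simp add: floquet_def)
  have rec: "of_real (weight0 T a n) * \<psi> n + of_real (b (Suc n)) * \<psi> (Suc n)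
          + of_real (a (Suc n)) * \<psi> (Suc (Suc n)) = of_real x * \<psi> (Suc n)"
    using fl by (simp add: floquet_def)
  have wr: "a (Suc n) * Im (cnj (\<psi> (Suc n)) * \<psi> (Suc (Suc n))) = \<omega>"
    using fl unfolding floquet_def by (metis weight0_def nat.distinct(1))
  have "Re (?z n * (of_real (weight0 T a n) * \<psi> n + of_real (b (Suc n)) * \<psi> (Suc n)
          + of_real (a (Suc n)) * \<psi> (Suc (Suc n)))) = Re (?z n * (of_real x * \<psi> (Suc n)))"
    by (simp only: rec)
  then have free: "weight0 T a n * Re (?z n * \<psi> n) + b (Suc n) * Re (?z n * \<psi> (Suc n))
       + a (Suc n) * Re (?z n * \<psi> (Suc (Suc n))) = x * Re (?z n * \<psi> (Suc n))"
    by (simp add: algebra_simps)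
  have nxt: "u (Suc (Suc n)) = Re (?z (Suc n) * \<psi> (Suc (Suc n)))"
    using perturbed_solution_Suc[of \<omega> \<psi> q "Suc n"] by (simp add: u_def)
  have kick: "Re (?z (Suc n) * \<psi> (Suc (Suc n))) = Re (?z n * \<psi> (Suc (Suc n)))
      - q (Suc n) / \<omega> * u (Suc n) * Im (cnj (\<psi> (Suc n)) * \<psi> (Suc (Suc n)))"
    using perturbed_solution_Suc[of \<omega> \<psi> q n]
    by (simp add: u_def algebra_simps diff_divide_distrib add_divide_distrib)
  have "a (Suc n) * u (Suc (Suc n)) = a (Suc n) * Re (?z n * \<psi> (Suc (Suc n)))
      - q (Suc n) / \<omega> * u (Suc n) * (a (Suc n) * Im (cnj (\<psi> (Suc n)) * \<psi> (Suc (Suc n))))"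
    unfolding nxt kick by (simp only: right_diff_distrib mult.assoc mult.left_commute mult.commute)
  also have "\<dots> = a (Suc n) * Re (?z n * \<psi> (Suc (Suc n))) - q (Suc n) * u (Suc n)"
    unfolding wr using om by simp
  finally show ?thesis
    using free perturbed_solution_Suc[of \<omega> \<psi> q n]
    by (simp add: u_def perturbed_solution_def[of _ _ _ n] algebra_simps)
qed

lemma perturbed_solution_eigenvector:
  fixes q :: "nat \<Rightarrow> real"
  assumes per: "periodic_coeffs T a b" and fl: "floquet T a b x \<psi> \<omega> \<tau>"
    and decay: "\<And>n. real n * cmod (amplitude \<omega> \<psi> q n) \<le> C"
  defines "u \<equiv> perturbed_solution \<omega> \<psi> q"
  shows "u \<in> l2_real" and "u \<noteq> (\<lambda>n. 0)"
    and "(\<lambda>n. jacobi_op a b u n + diag_op q u n) = (\<lambda>n. x * u n)"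
proof -
  have u0: "u 0 = 0" by (simp add: u_def perturbed_solution_def algebra_simps)
  obtain B where B: "B > 0" "\<And>n. cmod (\<psi> n) \<le> B"
    using floquet_bounded[of T \<tau> \<psi>] fl per by (auto simp: floquet_def periodic_coeffs_def)
  have "(u (Suc n))\<^sup>2 \<le> (C * B)\<^sup>2 * inverse ((real (Suc n))\<^sup>2)" for n
  proof -
    have "C \<ge> 0" using decay[of 0] by simp
    have "\<bar>u (Suc n)\<bar> \<le> cmod (amplitude \<omega> \<psi> q (Suc n)) * cmod (\<psi> (Suc n))"
      unfolding u_def perturbed_solution_def by (metis abs_Re_le_cmod norm_mult)
    also have "\<dots> \<le> (C / real (Suc n)) * B"
      using decay[of "Suc n"] B(1) B(2)[of "Suc n"] \<open>C \<ge> 0\<close>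
      by (intro mult_mono) (auto simp: field_simps)
    finally have "\<bar>u (Suc n)\<bar> \<le> \<bar>C / real (Suc n) * B\<bar>" by linarith
    then have "(u (Suc n))\<^sup>2 \<le> (C / real (Suc n) * B)\<^sup>2" by (simp only: abs_le_square_iff)
    then show ?thesis by (simp add: power_mult_distrib power_divide divide_simps)
  qed
  moreover have "summable (\<lambda>n. (C * B)\<^sup>2 * inverse ((real (Suc n))\<^sup>2))"
    using inverse_power_summable[of 2, where 'a = real]
    by (intro summable_mult) (subst summable_Suc_iff[of "\<lambda>n. inverse ((real n)\<^sup>2)"], simp)
  ultimately have "summable (\<lambda>n. (u (Suc n))\<^sup>2)"
    by (intro summable_comparison_test[of "\<lambda>n. (u (Suc n))\<^sup>2"
          "\<lambda>n. (C * B)\<^sup>2 * inverse ((real (Suc n))\<^sup>2)"]) (auto simp del: of_nat_Suc)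
  then have "summable (\<lambda>n. (u n)\<^sup>2)" by (subst (asm) summable_Suc_iff[of "\<lambda>n. (u n)\<^sup>2"])
  then show "u \<in> l2_real" using u0 by (simp add: l2_real_def)
  have "u (Suc 0) = - Im (cnj (\<psi> 0) * \<psi> (Suc 0))"
    using perturbed_solution_Suc[of \<omega> \<psi> q 0] by (simp add: u_def algebra_simps)
  then show "u \<noteq> (\<lambda>n. 0)" using floquet_wronskian_nonzero[OF fl, of 0] by (metis neg_equal_0_iff_equal)
  show "(\<lambda>n. jacobi_op a b u n + diag_op q u n) = (\<lambda>n. x * u n)"
  proof
    fix n
    show "jacobi_op a b u n + diag_op q u n = x * u n"
    proof (cases n)
      case 0
      then show ?thesis using u0 by (simp add: jacobi_op_def diag_op_def)
    next
      case (Suc m)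
      show ?thesis
        using perturbed_solution_recurrence[OF per fl, of m q, folded u_def] u0
        by (cases m) (auto simp: Suc jacobi_op_def diag_op_def weight0_def numeral_2_eq_2 algebra_simps)
    qed
  qed
qed

text \<open>
  Signs occur twice in every increment and cancel. With \<open>floquet_chiral\<close> this turns the amplitude for
  \<open>- \<omega>\<close> into the amplitude of the mirror energy.
\<close>

lemma amplitude_chiral: "amplitude \<omega> (\<lambda>n. (-1) ^ n * \<phi> n) q n = amplitude \<omega> \<phi> q n"
proof (induction n)
  case (Suc n)
  have "(-1::complex) ^ n = 1 \<or> (-1::complex) ^ n = - 1" by (cases "even n") auto
  then show ?case using Suc by (auto simp: algebra_simps diff_divide_distrib)
qed simp

section \<open>Amplitudes over a block of small potential\<close>

text \<open>
  Every site acts by the identity plus an operator of norm at most \<open>\<delta>\<close>. Expanding the product of these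
  operators, the terms of degree 2 and higher are dominated by those of \<open>(1 + \<delta>) ^ j\<close>.
\<close>

lemma amplitude_block_error:
  fixes q :: "nat \<Rightarrow> real" and \<phi> :: "nat \<Rightarrow> complex" and \<omega> \<delta> :: real
  assumes \<delta>: "\<delta> \<ge> 0" and small: "\<forall>k\<in>{1..l}. \<bar>q (N + k) / \<omega>\<bar> * (cmod (\<phi> (N + k)))\<^sup>2 \<le> \<delta>"
  defines "z \<equiv> amplitude \<omega> \<phi> q"
  defines "S \<equiv> \<lambda>j. \<Sum>k=1..j. \<i> * of_real (q (N + k) / \<omega> * Re (z N * \<phi> (N + k))) * cnj (\<phi> (N + k))"
  assumes "j \<le> l"
  shows "cmod (z (N + j)) \<le> (1 + \<delta>) ^ j * cmod (z N)"
    and "cmod (z (N + j) - z N) \<le> ((1 + \<delta>) ^ j - 1) * cmod (z N)"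
    and "cmod (z (N + j) - z N - S j) \<le> ((1 + \<delta>) ^ j - 1 - real j * \<delta>) * cmod (z N)"
proof -
  define Kk where "Kk k v = \<i> * of_real (q (N + k) / \<omega> * Re (v * \<phi> (N + k))) * cnj (\<phi> (N + k))" for k v
  have Kk: "cmod (Kk k v) \<le> \<delta> * cmod v" if "1 \<le> k" "k \<le> l" for k v
  proof -
    have "cmod (Kk k v) = \<bar>q (N + k) / \<omega>\<bar> * \<bar>Re (v * \<phi> (N + k))\<bar> * cmod (\<phi> (N + k))"
      by (simp add: Kk_def norm_mult norm_divide abs_mult del: times_complex.sel)
    also have "\<dots> \<le> \<bar>q (N + k) / \<omega>\<bar> * (cmod v * cmod (\<phi> (N + k))) * cmod (\<phi> (N + k))"
      by (intro mult_right_mono mult_left_mono)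
        (auto simp del: times_complex.sel simp flip: norm_mult intro: abs_Re_le_cmod)
    also have "\<dots> = (\<bar>q (N + k) / \<omega>\<bar> * (cmod (\<phi> (N + k)))\<^sup>2) * cmod v"
      by (simp add: power2_eq_square)
    also have "\<dots> \<le> \<delta> * cmod v" using small that by (intro mult_right_mono) auto
    finally show ?thesis .
  qed
  have diff: "Kk k v - Kk k v' = Kk k (v - v')" for k v v'
    by (simp add: Kk_def left_diff_distrib right_diff_distrib del: times_complex.sel)
  have step: "z (N + Suc j) = z (N + j) + Kk (Suc j) (z (N + j))" for j
    by (simp add: z_def Kk_def)
  have S: "S (Suc j) = S j + Kk (Suc j) (z N)" for j by (simp add: S_def Kk_def)
  have "cmod (z (N + j)) \<le> (1 + \<delta>) ^ j * cmod (z N) \<and>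
      cmod (z (N + j) - z N) \<le> ((1 + \<delta>) ^ j - 1) * cmod (z N) \<and>
      cmod (z (N + j) - z N - S j) \<le> ((1 + \<delta>) ^ j - 1 - real j * \<delta>) * cmod (z N)"
    using \<open>j \<le> l\<close>
  proof (induction j)
    case 0
    show ?case by (simp add: S_def)
  next
    case (Suc j)
    then have j: "1 \<le> Suc j" "Suc j \<le> l" and
      IH: "cmod (z (N + j)) \<le> (1 + \<delta>) ^ j * cmod (z N)"
      "cmod (z (N + j) - z N) \<le> ((1 + \<delta>) ^ j - 1) * cmod (z N)"
      "cmod (z (N + j) - z N - S j) \<le> ((1 + \<delta>) ^ j - 1 - real j * \<delta>) * cmod (z N)" by auto
    have k1: "cmod (Kk (Suc j) (z (N + j))) \<le> \<delta> * ((1 + \<delta>) ^ j * cmod (z N))"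
      using Kk[OF j, of "z (N + j)"] mult_left_mono[OF IH(1) \<delta>] by linarith
    have k2: "cmod (Kk (Suc j) (z (N + j) - z N)) \<le> \<delta> * (((1 + \<delta>) ^ j - 1) * cmod (z N))"
      using Kk[OF j, of "z (N + j) - z N"] mult_left_mono[OF IH(2) \<delta>] by linarith
    have "cmod (z (N + Suc j)) \<le> cmod (z (N + j)) + cmod (Kk (Suc j) (z (N + j)))"
      unfolding step by (rule norm_triangle_ineq)
    also have "\<dots> \<le> (1 + \<delta>) ^ j * cmod (z N) + \<delta> * ((1 + \<delta>) ^ j * cmod (z N))" using IH(1) k1 by (rule add_mono)
    finally have 1: "cmod (z (N + Suc j)) \<le> (1 + \<delta>) ^ Suc j * cmod (z N)" by (simp add: algebra_simps)
    have "cmod (z (N + Suc j) - z N) = cmod ((z (N + j) - z N) + Kk (Suc j) (z (N + j)))"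
      unfolding step by (simp add: algebra_simps)
    also have "\<dots> \<le> cmod (z (N + j) - z N) + cmod (Kk (Suc j) (z (N + j)))" by (rule norm_triangle_ineq)
    also have "\<dots> \<le> ((1 + \<delta>) ^ j - 1) * cmod (z N) + \<delta> * ((1 + \<delta>) ^ j * cmod (z N))" using IH(2) k1 by (rule add_mono)
    finally have 2: "cmod (z (N + Suc j) - z N) \<le> ((1 + \<delta>) ^ Suc j - 1) * cmod (z N)" by (simp add: algebra_simps)
    have "cmod (z (N + Suc j) - z N - S (Suc j)) = cmod ((z (N + j) - z N - S j) + Kk (Suc j) (z (N + j) - z N))"
      unfolding step S diff[symmetric] by (simp add: algebra_simps)
    also have "\<dots> \<le> cmod (z (N + j) - z N - S j) + cmod (Kk (Suc j) (z (N + j) - z N))" by (rule norm_triangle_ineq)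
    also have "\<dots> \<le> ((1 + \<delta>) ^ j - 1 - real j * \<delta>) * cmod (z N) + \<delta> * (((1 + \<delta>) ^ j - 1) * cmod (z N))" using IH(3) k2 by (rule add_mono)
    finally have 3: "cmod (z (N + Suc j) - z N - S (Suc j)) \<le> ((1 + \<delta>) ^ Suc j - 1 - real (Suc j) * \<delta>) * cmod (z N)" by (simp add: algebra_simps)
    show ?case using 1 2 3 by blast
  qed
  then show "cmod (z (N + j)) \<le> (1 + \<delta>) ^ j * cmod (z N)"
    and "cmod (z (N + j) - z N) \<le> ((1 + \<delta>) ^ j - 1) * cmod (z N)"
    and "cmod (z (N + j) - z N - S j) \<le> ((1 + \<delta>) ^ j - 1 - real j * \<delta>) * cmod (z N)"
    by blast+
qed

lemma power_one_plus_bound: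
  fixes \<delta> :: real
  assumes "\<delta> \<ge> 0" and "real l * \<delta> \<le> 1"
  shows "(1 + \<delta>) ^ l \<le> 1 + real l * \<delta> + (real l * \<delta>)\<^sup>2"
proof -
  have "(1 + \<delta>) ^ l \<le> exp \<delta> ^ l" using assms exp_ge_add_one_self[of \<delta>] by (intro power_mono) auto
  also have "\<dots> = exp (real l * \<delta>)" by (simp add: exp_of_nat_mult)
  also have "\<dots> \<le> 1 + real l * \<delta> + (real l * \<delta>)\<^sup>2" using assms by (intro exp_bound) auto
  finally show ?thesis .
qed

text \<open>
  By the assumption on \<open>F\<close> and \<open>G\<close> the first-order increments add up to \<open>- \<epsilon> r z\<close>; the rest is the error of
  \<open>amplitude_block_error\<close>, in which \<open>l \<delta>\<close> is at most \<open>A \<epsilon>\<close>.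
\<close>

lemma controlled_block:
  fixes q d :: "nat \<Rightarrow> real" and \<phi> :: "nat \<Rightarrow> complex" and \<omega> \<epsilon> A Q B G r :: real
  assumes om: "\<omega> \<noteq> 0" and B: "\<And>n. cmod (\<phi> n) \<le> B"
    and \<epsilon>: "\<epsilon> \<ge> 0" and q: "\<forall>k\<in>{1..l}. q (N + k) = \<epsilon> * d k"
    and Q: "\<forall>k\<in>{1..l}. \<bar>d k\<bar> \<le> Q"
    and A: "real l * Q * B\<^sup>2 / \<bar>\<omega>\<bar> \<le> A" and A1: "A * \<epsilon> \<le> 1" and "l > 0"
    and F: "(\<Sum>k=1..l. of_real (d k) * (\<phi> (N + k))\<^sup>2) = F"
    and G: "(\<Sum>k=1..l. d k * (cmod (\<phi> (N + k)))\<^sup>2) = G"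
  defines "z \<equiv> amplitude \<omega> \<phi> q"
  assumes target: "of_real G * z N + cnj F * cnj (z N) = 2 * \<i> * of_real (\<omega> * r) * z N"
  shows "cmod (z (N + l) - of_real (1 - \<epsilon> * r) * z N) \<le> A\<^sup>2 * \<epsilon>\<^sup>2 * cmod (z N)"
    and "j \<le> l \<Longrightarrow> cmod (z (N + j)) \<le> 3 * cmod (z N)"
proof -
  define \<delta> where "\<delta> = \<epsilon> * Q * B\<^sup>2 / \<bar>\<omega>\<bar>"
  have "\<bar>d 1\<bar> \<le> Q" using Q \<open>l > 0\<close> by (simp add: Suc_leI)
  then have "Q \<ge> 0" by linarith
  then have \<delta>: "\<delta> \<ge> 0" using \<epsilon> by (simp add: \<delta>_def)
  have small: "\<forall>k\<in>{1..l}. \<bar>q (N + k) / \<omega>\<bar> * (cmod (\<phi> (N + k)))\<^sup>2 \<le> \<delta>"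
  proof
    fix k assume that: "k \<in> {1..l}"
    have "\<bar>q (N + k) / \<omega>\<bar> * (cmod (\<phi> (N + k)))\<^sup>2 = \<epsilon> * \<bar>d k\<bar> * (cmod (\<phi> (N + k)))\<^sup>2 / \<bar>\<omega>\<bar>"
      using q that \<epsilon> by (simp add: abs_mult)
    also have "\<dots> \<le> \<epsilon> * Q * B\<^sup>2 / \<bar>\<omega>\<bar>"
      using bspec[OF Q that] B[of "N + k"] \<epsilon> \<open>Q \<ge> 0\<close>
      by (intro divide_right_mono mult_mono power_mono) auto
    finally show "\<bar>q (N + k) / \<omega>\<bar> * (cmod (\<phi> (N + k)))\<^sup>2 \<le> \<delta>" by (simp add: \<delta>_def)
  qed
  have ld: "real l * \<delta> \<le> A * \<epsilon>"
    using mult_right_mono[OF A \<epsilon>] by (simp add: \<delta>_def mult_ac)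
  then have ld1: "real l * \<delta> \<le> 1" using A1 by linarith
  have ld0: "real l * \<delta> \<ge> 0" using \<delta> by simp
  define S where "S = (\<Sum>k=1..l. \<i> * of_real (q (N + k) / \<omega> * Re (z N * \<phi> (N + k))) * cnj (\<phi> (N + k)))"
  note err = amplitude_block_error[where q = q and N = N and l = l and \<phi> = \<phi> and \<omega> = \<omega>, OF \<delta> small, folded z_def]
  have S: "S = - of_real (\<epsilon> * r) * z N"
  proof -
    have summand: "\<i> * of_real (q (N + k) / \<omega> * Re (z N * \<phi> (N + k))) * cnj (\<phi> (N + k))
       = \<i> * of_real (\<epsilon> / (2 * \<omega>)) * (of_real (d k * (cmod (\<phi> (N + k)))\<^sup>2) * z N
           + cnj (of_real (d k) * (\<phi> (N + k))\<^sup>2) * cnj (z N))" if "k \<in> {1..l}" for k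
    proof -
      have re: "complex_of_real (Re (z N * \<phi> (N + k))) = (z N * \<phi> (N + k) + cnj (z N * \<phi> (N + k))) / 2"
        by (simp only: complex_add_cnj) simp
      have nrm: "complex_of_real ((cmod (\<phi> (N + k)))\<^sup>2) = \<phi> (N + k) * cnj (\<phi> (N + k))"
        by (rule complex_norm_square)
      have qk: "q (N + k) = \<epsilon> * d k" using q that by auto
      show ?thesis
        unfolding qk of_real_mult of_real_divide re nrm complex_cnj_mult complex_cnj_power complex_cnj_complex_of_real
        by (simp add: power2_eq_square algebra_simps add_divide_distrib)
    qed
    have "S = \<i> * of_real (\<epsilon> / (2 * \<omega>)) * (of_real (\<Sum>k=1..l. d k * (cmod (\<phi> (N + k)))\<^sup>2) * z N
         + cnj (\<Sum>k=1..l. of_real (d k) * (\<phi> (N + k))\<^sup>2) * cnj (z N))"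
      unfolding S_def
      by (simp only: summand cong: sum.cong) (simp only: sum_distrib_left sum_distrib_right cnj_sum of_real_sum sum.distrib distrib_left)
    also have "\<dots> = \<i> * of_real (\<epsilon> / (2 * \<omega>)) * (2 * \<i> * of_real (\<omega> * r) * z N)"
      unfolding F G target ..
    also have "\<dots> = - of_real (\<epsilon> * r) * z N" using om by (simp add: field_simps)
    finally show ?thesis .
  qed
  have pb: "(1 + \<delta>) ^ l \<le> 1 + real l * \<delta> + (real l * \<delta>)\<^sup>2" by (rule power_one_plus_bound[OF \<delta> ld1])
  have "cmod (z (N + l) - z N - S) \<le> ((1 + \<delta>) ^ l - 1 - real l * \<delta>) * cmod (z N)"
    using err(3)[of l] by (simp add: S_def z_def)
  also have "\<dots> \<le> (A\<^sup>2 * \<epsilon>\<^sup>2) * cmod (z N)"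
  proof (rule mult_right_mono)
    have "(real l * \<delta>)\<^sup>2 \<le> (A * \<epsilon>)\<^sup>2" using ld ld0 by (intro power_mono)
    then show "(1 + \<delta>) ^ l - 1 - real l * \<delta> \<le> A\<^sup>2 * \<epsilon>\<^sup>2" using pb by (simp add: power_mult_distrib)
  qed simp
  finally show "cmod (z (N + l) - of_real (1 - \<epsilon> * r) * z N) \<le> A\<^sup>2 * \<epsilon>\<^sup>2 * cmod (z N)"
    unfolding S by (simp add: algebra_simps)
  show "cmod (z (N + j)) \<le> 3 * cmod (z N)" if j: "j \<le> l"
  proof -
    have "(real l * \<delta>)\<^sup>2 \<le> 1" using ld1 ld0 by (intro power_le_one)
    then have "(1 + \<delta>) ^ l \<le> 3" using pb ld1 by linarith
    moreover have "(1 + \<delta>) ^ j \<le> (1 + \<delta>) ^ l" using j \<delta> by (intro power_increasing) auto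
    ultimately have "(1 + \<delta>) ^ j * cmod (z N) \<le> 3 * cmod (z N)" by (intro mult_right_mono) auto
    then show ?thesis using err(1)[OF j] by (simp add: z_def)
  qed
qed

text \<open>
  The factor \<open>N / (N + l)\<close> makes \<open>N * cmod z\<close> nonincreasing along consecutive blocks, whatever their lengths are.
\<close>

definition contracts :: "real \<Rightarrow> (nat \<Rightarrow> complex) \<Rightarrow> (nat \<Rightarrow> real) \<Rightarrow> nat \<Rightarrow> nat \<Rightarrow> bool" where
  "contracts \<omega> \<phi> q N l \<longleftrightarrow>
     real (N + l) * cmod (amplitude \<omega> \<phi> q (N + l)) \<le> real N * cmod (amplitude \<omega> \<phi> q N) \<and>
     (\<forall>j\<le>l. cmod (amplitude \<omega> \<phi> q (N + j)) \<le> 3 * cmod (amplitude \<omega> \<phi> q N))"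

text \<open>
  The quantity \<open>\<zeta>\<close> that has to be kept in its quadrant for energies with a mirror image.
\<close>

definition amplitude_ratio :: "real \<Rightarrow> (nat \<Rightarrow> complex) \<Rightarrow> (nat \<Rightarrow> real) \<Rightarrow> nat \<Rightarrow> complex" where
  "amplitude_ratio \<omega> \<phi> q n = amplitude (- \<omega>) \<phi> q n / amplitude \<omega> \<phi> q n"

lemma contracts_cong:
  assumes "\<And>n. 1 \<le> n \<Longrightarrow> n \<le> N + l \<Longrightarrow> q n = q' n"
  shows "contracts \<omega> \<phi> q N l \<longleftrightarrow> contracts \<omega> \<phi> q' N l"
proof -
  have "amplitude \<omega> \<phi> q n = amplitude \<omega> \<phi> q' n" if "n \<le> N + l" for n
    using that assms by (intro amplitude_cong) auto
  then show ?thesis by (simp add: contracts_def)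
qed

lemma contracting_blocks_decay:
  fixes Nn l :: "nat \<Rightarrow> nat"
  assumes step: "\<And>k. Nn (Suc k) = Nn k + l k" and pos: "\<And>k. l k > 0" and short: "\<And>k. l k \<le> Nn k"
    and contr: "\<And>k. k \<ge> k\<^sub>0 \<Longrightarrow> contracts \<omega> \<phi> q (Nn k) (l k)"
  shows "\<exists>C. \<forall>n. real n * cmod (amplitude \<omega> \<phi> q n) \<le> C"
proof -
  define y where "y n = real n * cmod (amplitude \<omega> \<phi> q n)" for n
  have dec: "y (Nn k) \<le> y (Nn k\<^sub>0)" if "k \<ge> k\<^sub>0" for k
    using that
  proof (induction k rule: dec_induct)
    case (step k)
    then show ?case using contr[of k] assms(1)[of k] by (simp add: contracts_def y_def)
  qed simp
  have mono: "strict_mono Nn" by (rule strict_monoI_Suc) (simp add: step pos)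
  have late: "y n \<le> 6 * y (Nn k\<^sub>0)" if n: "n \<ge> Nn k\<^sub>0" for n
  proof -
    define k where "k = (GREATEST k. Nn k \<le> n)"
    have bd: "k \<le> n" if "Nn k \<le> n" for k using strict_mono_imp_increasing[OF mono, of k] that by linarith
    have k: "Nn k \<le> n" unfolding k_def using n bd by (rule GreatestI_nat)
    have kmax: "j \<le> k" if "Nn j \<le> n" for j unfolding k_def using that bd by (rule Greatest_le_nat)
    have "k \<ge> k\<^sub>0" by (rule kmax[OF n])
    have "n < Nn (Suc k)" using kmax[of "Suc k"] by force
    then obtain j where j: "n = Nn k + j" "j \<le> l k" using k step[of k] by (metis le_iff_add less_imp_le nat_add_left_cancel_le)
    have "cmod (amplitude \<omega> \<phi> q n) \<le> 3 * cmod (amplitude \<omega> \<phi> q (Nn k))"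
      using contr[OF \<open>k \<ge> k\<^sub>0\<close>] j by (simp add: contracts_def)
    moreover have "real n \<le> 2 * real (Nn k)" using j short[of k] by simp
    ultimately have "y n \<le> (2 * real (Nn k)) * (3 * cmod (amplitude \<omega> \<phi> q (Nn k)))"
      unfolding y_def by (intro mult_mono) auto
    also have "\<dots> = 6 * y (Nn k)" by (simp add: y_def)
    finally show ?thesis using dec[OF \<open>k \<ge> k\<^sub>0\<close>] by simp
  qed
  have y0: "y n \<ge> 0" for n by (simp add: y_def)
  have "y n \<le> (\<Sum>m\<le>Nn k\<^sub>0. y m) + 6 * y (Nn k\<^sub>0)" for n
  proof (cases "n \<le> Nn k\<^sub>0")
    case True
    then have "y n \<le> (\<Sum>m\<le>Nn k\<^sub>0. y m)" using y0 by (intro member_le_sum) auto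
    then show ?thesis using y0[of "Nn k\<^sub>0"] by simp
  next
    case False
    then have "y n \<le> 6 * y (Nn k\<^sub>0)" using late by simp
    moreover have "(\<Sum>m\<le>Nn k\<^sub>0. y m) \<ge> 0" using y0 by (intro sum_nonneg) auto
    ultimately show ?thesis by linarith
  qed
  then show ?thesis unfolding y_def by blast
qed

lemma amplitude_unperturbed:
  assumes "\<And>n. N < n \<Longrightarrow> n \<le> M \<Longrightarrow> q n = 0" and "N \<le> M"
  shows "amplitude \<omega> \<phi> q M = amplitude \<omega> \<phi> q N"
  using assms(2,1) by (induction M rule: dec_induct) auto

section \<open>Prescribing the first-order effect of a block\<close>

text \<open>
  Floquet solutions for a family of energies, no three of which share their \<open>(\<tau> i)\<^sup>2\<close>. Energies enter the
  motion of the amplitudes only through \<open>\<psi>\<close> and \<open>\<omega>\<close>.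
\<close>

locale floquet_family =
  fixes T :: nat and E :: "nat set"
    and \<psi> :: "nat \<Rightarrow> nat \<Rightarrow> complex" and \<omega> :: "nat \<Rightarrow> real" and \<tau> :: "nat \<Rightarrow> complex"
  assumes T_pos: "T \<ge> 1"
    and shift: "i \<in> E \<Longrightarrow> \<psi> i (n + T) = \<tau> i * \<psi> i n"
    and unit: "i \<in> E \<Longrightarrow> cmod (\<tau> i) = 1"
    and upper: "i \<in> E \<Longrightarrow> Im ((\<tau> i)\<^sup>2) > 0"
    and wronskian: "i \<in> E \<Longrightarrow> \<omega> i * Im (cnj (\<psi> i n) * \<psi> i (Suc n)) > 0"
    and resonance_pairs: "\<lbrakk>i \<in> E; j \<in> E; k \<in> E; (\<tau> j)\<^sup>2 = (\<tau> i)\<^sup>2; (\<tau> k)\<^sup>2 = (\<tau> i)\<^sup>2; j \<noteq> i; k \<noteq> i\<rbrakk> \<Longrightarrow> j = k"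
    and squares: "\<lbrakk>i \<in> E; j \<in> E; i \<noteq> j; (\<tau> j)\<^sup>2 = (\<tau> i)\<^sup>2\<rbrakk> \<Longrightarrow>
      \<exists>m\<ge>1. \<exists>n\<ge>1. (\<psi> i m)\<^sup>2 * (\<psi> j n)\<^sup>2 \<noteq> (\<psi> i n)\<^sup>2 * (\<psi> j m)\<^sup>2"
begin

lemma nonzero:
  assumes "i \<in> E"
  shows "\<psi> i n \<noteq> 0" and "\<omega> i \<noteq> 0"
  using wronskian[OF assms, of n] by auto

text \<open>
  The potential profile \<open>d\<close> has first-order effects \<open>f i\<close> (resonant part) and \<open>g i\<close> (mean part) on the \<open>i\<close>-th
  amplitude over a block of any length from \<open>L\<close> on; thus profiles of different length can be added.
\<close>

definition realizes :: "(nat \<Rightarrow> real) \<Rightarrow> nat \<Rightarrow> (nat \<Rightarrow> complex) \<Rightarrow> (nat \<Rightarrow> real) \<Rightarrow> bool" where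
  "realizes d L f g \<longleftrightarrow> (\<forall>L'\<ge>L. \<forall>i\<in>E.
     (\<Sum>n=1..L'. of_real (d n) * (\<psi> i n)\<^sup>2) = f i \<and> (\<Sum>n=1..L'. d n * (cmod (\<psi> i n))\<^sup>2) = g i)"

definition achievable :: "(nat \<Rightarrow> complex) \<Rightarrow> (nat \<Rightarrow> real) \<Rightarrow> bool" where
  "achievable f g \<longleftrightarrow> (\<exists>d L. realizes d L f g)"

lemma realizesD:
  assumes "realizes d L f g" and "L' \<ge> L" and "i \<in> E"
  shows "(\<Sum>n=1..L'. of_real (d n) * (\<psi> i n)\<^sup>2) = f i"
    and "(\<Sum>n=1..L'. d n * (cmod (\<psi> i n))\<^sup>2) = g i"
  using assms by (auto simp: realizes_def)

lemma achievableI: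
  assumes "\<And>L' i. L' \<ge> L \<Longrightarrow> i \<in> E \<Longrightarrow> (\<Sum>n=1..L'. of_real (d n) * (\<psi> i n)\<^sup>2) = f i"
    and "\<And>L' i. L' \<ge> L \<Longrightarrow> i \<in> E \<Longrightarrow> (\<Sum>n=1..L'. d n * (cmod (\<psi> i n))\<^sup>2) = g i"
  shows "achievable f g"
proof -
  have "realizes d L f g" using assms by (simp add: realizes_def)
  then show ?thesis unfolding achievable_def by blast
qed

text \<open>
  The profile concentrated at one site \<open>m\<close>.
\<close>

lemma achievable_site:
  assumes "m \<ge> 1"
  shows "achievable (\<lambda>i. (\<psi> i m)\<^sup>2) (\<lambda>i. (cmod (\<psi> i m))\<^sup>2)"
proof (rule achievableI[where d = "\<lambda>n. if n = m then 1 else 0" and L = m])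
  fix L' i assume L: "L' \<ge> m"
  have "(\<Sum>n=1..L'. complex_of_real (if n = m then 1 else 0) * (\<psi> i n)\<^sup>2) =
      (\<Sum>n=1..L'. if n = m then (\<psi> i n)\<^sup>2 else 0)" by (intro sum.cong) auto
  then show "(\<Sum>n=1..L'. complex_of_real (if n = m then 1 else 0) * (\<psi> i n)\<^sup>2) = (\<psi> i m)\<^sup>2"
    using L assms by simp
  have "(\<Sum>n=1..L'. (if n = m then 1 else 0) * (cmod (\<psi> i n))\<^sup>2) =
      (\<Sum>n=1..L'. if n = m then (cmod (\<psi> i n))\<^sup>2 else 0)" by (intro sum.cong) auto
  then show "(\<Sum>n=1..L'. (if n = m then 1 else 0) * (cmod (\<psi> i n))\<^sup>2) = (cmod (\<psi> i m))\<^sup>2"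
    using L assms by simp
qed

lemma achievable_lincomb:
  assumes "achievable f g" and "achievable f' g'"
  shows "achievable (\<lambda>i. of_real r * f i + of_real s * f' i) (\<lambda>i. r * g i + s * g' i)"
proof -
  obtain d L where "realizes d L f g"
    using assms(1) unfolding achievable_def by blast
  note d = realizesD[OF this]
  obtain e M where "realizes e M f' g'"
    using assms(2) unfolding achievable_def by blast
  note e = realizesD[OF this]
  show ?thesis
  proof (rule achievableI[where d = "\<lambda>n. r * d n + s * e n" and L = "max L M"])
    fix L' i assume L: "L' \<ge> max L M" and i: "i \<in> E"
    have "(\<Sum>n=1..L'. of_real (r * d n + s * e n) * (\<psi> i n)\<^sup>2) =
       of_real r * (\<Sum>n=1..L'. of_real (d n) * (\<psi> i n)\<^sup>2) + of_real s * (\<Sum>n=1..L'. of_real (e n) * (\<psi> i n)\<^sup>2)"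
      by (simp add: distrib_right sum.distrib sum_distrib_left mult.assoc)
    then show "(\<Sum>n=1..L'. of_real (r * d n + s * e n) * (\<psi> i n)\<^sup>2) = of_real r * f i + of_real s * f' i"
      using d(1) e(1) L i by simp
    have "(\<Sum>n=1..L'. (r * d n + s * e n) * (cmod (\<psi> i n))\<^sup>2) =
       r * (\<Sum>n=1..L'. d n * (cmod (\<psi> i n))\<^sup>2) + s * (\<Sum>n=1..L'. e n * (cmod (\<psi> i n))\<^sup>2)"
      by (simp add: distrib_right sum.distrib sum_distrib_left mult.assoc)
    then show "(\<Sum>n=1..L'. (r * d n + s * e n) * (cmod (\<psi> i n))\<^sup>2) = r * g i + s * g' i"
      using d(2) e(2) L i by simp
  qed
qed

lemma sum_block_shift:
  fixes h :: "nat \<Rightarrow> 'b::comm_monoid_add"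
  assumes "\<And>n. n \<le> T \<Longrightarrow> h n = 0" and "L' \<ge> T"
  shows "(\<Sum>n=1..L'. h n) = (\<Sum>n=1..L'-T. h (n + T))"
proof -
  have "(\<Sum>n=1..L'. h n) = (\<Sum>n=1+T..L'-T+T. h n)"
    using assms by (intro sum.mono_neutral_right) auto
  also have "\<dots> = (\<Sum>n=1..L'-T. h (n + T))" by (rule sum.shift_bounds_cl_nat_ivl)
  finally show ?thesis .
qed

text \<open>
  Translating a profile by one period.
\<close>

lemma achievable_shift:
  assumes "achievable f g"
  shows "achievable (\<lambda>i. (\<tau> i)\<^sup>2 * f i) g"
proof -
  obtain d L where "realizes d L f g"
    using assms unfolding achievable_def by blast
  note d = realizesD[OF this]
  define e where "e n = (if n \<le> T then 0 else d (n - T))" for n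
  show ?thesis
  proof (rule achievableI[where d = e and L = "L + T"])
    fix L' i assume L: "L' \<ge> L + T" and i: "i \<in> E"
    have e: "e (n + T) = d n" if "n \<ge> 1" for n using that by (simp add: e_def)
    have "(\<Sum>n=1..L'. of_real (e n) * (\<psi> i n)\<^sup>2) = (\<Sum>n=1..L'-T. of_real (e (n + T)) * (\<psi> i (n + T))\<^sup>2)"
      using L by (intro sum_block_shift) (auto simp: e_def)
    also have "\<dots> = (\<Sum>n=1..L'-T. (\<tau> i)\<^sup>2 * (of_real (d n) * (\<psi> i n)\<^sup>2))"
      using e shift[OF i] by (intro sum.cong) (auto simp: power_mult_distrib)
    finally show "(\<Sum>n=1..L'. of_real (e n) * (\<psi> i n)\<^sup>2) = (\<tau> i)\<^sup>2 * f i"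
      using d(1)[of "L' - T" i] L i by (simp flip: sum_distrib_left)
    have "(\<Sum>n=1..L'. e n * (cmod (\<psi> i n))\<^sup>2) = (\<Sum>n=1..L'-T. e (n + T) * (cmod (\<psi> i (n + T)))\<^sup>2)"
      using L by (intro sum_block_shift) (auto simp: e_def)
    also have "\<dots> = (\<Sum>n=1..L'-T. d n * (cmod (\<psi> i n))\<^sup>2)"
      using e shift[OF i] unit[OF i] by (intro sum.cong) (auto simp: norm_mult)
    finally show "(\<Sum>n=1..L'. e n * (cmod (\<psi> i n))\<^sup>2) = g i"
      using d(2)[of "L' - T" i] L i by simp
  qed
qed

lemma achievable_cong:
  assumes "achievable f g" and "\<And>i. i \<in> E \<Longrightarrow> f i = f' i" and "\<And>i. i \<in> E \<Longrightarrow> g i = g' i"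
  shows "achievable f' g'"
proof -
  obtain d L where "realizes d L f g" using assms(1) unfolding achievable_def by blast
  then have "realizes d L f' g'" using assms(2,3) by (simp add: realizes_def)
  then show ?thesis unfolding achievable_def by blast
qed

lemma achievable_linear_filter:
  assumes "achievable f g"
  shows "achievable (\<lambda>i. (of_real r * (\<tau> i)\<^sup>2 + of_real s) * f i) (\<lambda>i. (r + s) * g i)"
  using achievable_lincomb[OF achievable_shift[OF assms] assms, of r s]
  by (rule achievable_cong) (simp_all add: algebra_simps)

lemma multiplier_quadratic:
  assumes "i \<in> E"
  shows "((\<tau> i)\<^sup>2)\<^sup>2 - of_real (2 * c) * (\<tau> i)\<^sup>2 + 1 = of_real (2 * (Re ((\<tau> i)\<^sup>2) - c)) * (\<tau> i)\<^sup>2"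
proof -
  have "cmod ((\<tau> i)\<^sup>2) = 1" using unit[OF assms] by (simp add: norm_power)
  then have "(\<tau> i)\<^sup>2 * cnj ((\<tau> i)\<^sup>2) = 1" by (metis complex_norm_square of_real_1 power_one)
  then have "((\<tau> i)\<^sup>2)\<^sup>2 - of_real (2 * c) * (\<tau> i)\<^sup>2 + 1
      = (\<tau> i)\<^sup>2 * ((\<tau> i)\<^sup>2 + cnj ((\<tau> i)\<^sup>2) - of_real (2 * c))"
    by (simp add: power2_eq_square algebra_simps)
  also have "(\<tau> i)\<^sup>2 + cnj ((\<tau> i)\<^sup>2) = of_real (2 * Re ((\<tau> i)\<^sup>2))" by (rule complex_add_cnj)
  finally show ?thesis by (simp add: algebra_simps)
qed

text \<open>
  The real polynomial \<open>X\<^sup>2 - 2 c X + 1\<close> in the shift has the roots of modulus 1 with real part \<open>c\<close>. It removes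
  the effect on the energies with \<open>Re ((\<tau> i)\<^sup>2) = c\<close> and on no others.
\<close>

lemma achievable_quadratic_filter:
  assumes "achievable f g"
  shows "achievable (\<lambda>i. of_real (2 * (Re ((\<tau> i)\<^sup>2) - c)) * (\<tau> i)\<^sup>2 * f i) (\<lambda>i. 2 * (1 - c) * g i)"
proof -
  have "achievable (\<lambda>i. of_real 1 * ((\<tau> i)\<^sup>2 * ((of_real 1 * (\<tau> i)\<^sup>2 + of_real (- (2 * c))) * f i)) + of_real 1 * f i)
     (\<lambda>i. 1 * ((1 + - (2 * c)) * g i) + 1 * g i)"
    by (intro achievable_lincomb achievable_shift achievable_linear_filter assms)
  then show ?thesis
  proof (rule achievable_cong)
    fix i assume "i \<in> E"
    from arg_cong[OF multiplier_quadratic[OF this, of c], of "\<lambda>t. t * f i"]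
    show "of_real 1 * ((\<tau> i)\<^sup>2 * ((of_real 1 * (\<tau> i)\<^sup>2 + of_real (- (2 * c))) * f i)) + of_real 1 * f i
      = of_real (2 * (Re ((\<tau> i)\<^sup>2) - c)) * (\<tau> i)\<^sup>2 * f i"
      by (simp add: power2_eq_square algebra_simps del: Re_power2 Im_power2)
  qed (simp add: algebra_simps)
qed

lemma achievable_product_filter:
  assumes "finite C" and "achievable f g"
  shows "achievable (\<lambda>i. (\<Prod>c\<in>C. of_real (2 * (Re ((\<tau> i)\<^sup>2) - c)) * (\<tau> i)\<^sup>2) * f i)
           (\<lambda>i. (\<Prod>c\<in>C. 2 * (1 - c)) * g i)"
  using assms(1)
proof (induction C rule: finite_induct)
  case (insert c C)
  from achievable_quadratic_filter[OF insert.IH, of c] show ?case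
    by (rule achievable_cong) (simp_all add: insert mult_ac)
qed (use assms in simp)

lemma multiplier_norm:
  assumes "i \<in> E"
  shows "(Re ((\<tau> i)\<^sup>2))\<^sup>2 + (Im ((\<tau> i)\<^sup>2))\<^sup>2 = 1"
proof -
  have "cmod ((\<tau> i)\<^sup>2) = 1" using unit[OF assms] by (simp add: norm_power)
  then show ?thesis by (simp only: cmod_def real_sqrt_eq_1_iff)
qed

lemma Re_multiplier_less:
  assumes "i \<in> E"
  shows "Re ((\<tau> i)\<^sup>2) < 1"
proof -
  have "(Im ((\<tau> i)\<^sup>2))\<^sup>2 > 0" using upper[OF assms] by (intro zero_less_power)
  then have "(Re ((\<tau> i)\<^sup>2))\<^sup>2 < 1" using multiplier_norm[OF assms] by linarith
  then have "\<bar>Re ((\<tau> i)\<^sup>2)\<bar> < 1" by (simp only: abs_square_less_1)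
  then show ?thesis by linarith
qed

lemma multiplier_eqI:
  assumes "i \<in> E" "j \<in> E" "Re ((\<tau> i)\<^sup>2) = Re ((\<tau> j)\<^sup>2)"
  shows "(\<tau> i)\<^sup>2 = (\<tau> j)\<^sup>2"
proof -
  have "(Im ((\<tau> i)\<^sup>2))\<^sup>2 = (Im ((\<tau> j)\<^sup>2))\<^sup>2"
    using multiplier_norm[OF assms(1)] multiplier_norm[OF assms(2)] unfolding assms(3) by linarith
  then have "Im ((\<tau> i)\<^sup>2) = Im ((\<tau> j)\<^sup>2)" using upper[OF assms(1)] upper[OF assms(2)]
    by (metis less_imp_le power2_eq_iff_nonneg)
  then show ?thesis using assms(3) by (intro complex_eqI)
qed

text \<open>
  Filtering out all multipliers leaves only the mean part. It survives because the filter does not vanish at 1.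
\<close>

lemma background_control:
  assumes "finite I" and "I \<subseteq> E"
  shows "\<exists>f g. achievable f g \<and> (\<forall>i\<in>I. f i = 0 \<and> g i = (cmod (\<psi> i 1))\<^sup>2)"
proof -
  define C where "C = (\<lambda>i. Re ((\<tau> i)\<^sup>2)) ` I"
  have C: "finite C" using assms by (simp add: C_def)
  define p where "p = (\<Prod>c\<in>C. 2 * (1 - c))"
  have "c < 1" if "c \<in> C" for c using that Re_multiplier_less assms(2) by (auto simp: C_def simp del: Re_power2)
  then have p: "p \<noteq> 0" using C by (auto simp: p_def)
  note ach = achievable_product_filter[OF C achievable_site[of 1, simplified], folded p_def]
  show ?thesis
    by (intro exI conjI, rule achievable_lincomb[OF ach ach, of "1 / p" 0])
      (use p C in \<open>auto simp: C_def\<close>)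
qed

text \<open>
  A filter removes the mean part (factor \<open>X - 1\<close>) and all multipliers other than that of \<open>i\<close>. A further real
  linear factor takes any complex value at that multiplier, since it is not real. If some \<open>j\<close> shares the
  multiplier, two sites at which the squares are independent give two linear equations in two complex
  unknowns.
\<close>

lemma isolating_control:
  assumes I: "finite I" "I \<subseteq> E" and i: "i \<in> I"
  shows "\<exists>f g. achievable f g \<and> f i = w \<and> (\<forall>j\<in>I. j \<noteq> i \<longrightarrow> f j = 0) \<and> (\<forall>j\<in>I. g j = 0)"
proof -
  define \<mu> where "\<mu> j = (\<tau> j)\<^sup>2" for j
  define C where "C = (\<lambda>j. Re (\<mu> j)) ` I - {Re (\<mu> i)}"
  have C: "finite C" using I by (simp add: C_def)
  \<comment> \<open>\<open>P j\<close> is the value of the filter at the multiplier of \<open>j\<close>.\<close>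
  define P where "P j = (of_real 1 * (\<tau> j)\<^sup>2 + of_real (-1)) * (\<Prod>c\<in>C. of_real (2 * (Re ((\<tau> j)\<^sup>2) - c)) * (\<tau> j)\<^sup>2)" for j
  have iE: "i \<in> E" using i I by auto
  have t0: "(\<tau> j)\<^sup>2 \<noteq> 0" if "j \<in> E" for j using upper[OF that] by auto
  have Pi: "P i \<noteq> 0"
  proof -
    have "(\<tau> i)\<^sup>2 \<noteq> 1" using upper[OF iE] by auto
    then show ?thesis using C t0[OF iE] by (auto simp: P_def C_def \<mu>_def)
  qed
  have Pj: "P j = (if \<mu> j = \<mu> i then P i else 0)" if "j \<in> I" for j
  proof (cases "Re (\<mu> j) = Re (\<mu> i)")
    case True
    then have "\<mu> j = \<mu> i" using multiplier_eqI[of j i] that I iE by (auto simp: \<mu>_def)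
    then show ?thesis by (simp add: P_def \<mu>_def)
  next
    case False
    then have "Re (\<mu> j) \<in> C" using that by (auto simp: C_def)
    then have "P j = 0" using C by (auto simp: P_def \<mu>_def intro!: prod_zero)
    then show ?thesis using False by auto
  qed
  \<comment> \<open>The linear factor \<open>r X + s\<close> takes the value \<open>z / P i\<close> at the multiplier of \<open>i\<close>.\<close>
  have site: "\<exists>f. achievable f (\<lambda>_. 0) \<and> (\<forall>j\<in>I. f j = (if \<mu> j = \<mu> i then z * (\<psi> j m)\<^sup>2 else 0))"
    if m: "m \<ge> 1" for z m
  proof -
    define r where "r = Im (z / P i) / Im (\<mu> i)"
    define s where "s = Re (z / P i) - r * Re (\<mu> i)"
    have "of_real r * \<mu> i + of_real s = z / P i"
      using upper[OF iE] by (simp add: complex_eq_iff r_def s_def \<mu>_def)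
    then have rs: "(of_real r * \<mu> i + of_real s) * P i = z" using Pi by simp
    have "achievable (\<lambda>j. (of_real r * (\<tau> j)\<^sup>2 + of_real s) * ((of_real 1 * (\<tau> j)\<^sup>2 + of_real (-1)) *
        ((\<Prod>c\<in>C. of_real (2 * (Re ((\<tau> j)\<^sup>2) - c)) * (\<tau> j)\<^sup>2) * (\<psi> j m)\<^sup>2)))
       (\<lambda>j. (r + s) * ((1 + (-1)) * ((\<Prod>c\<in>C. 2 * (1 - c)) * (cmod (\<psi> j m))\<^sup>2)))"
      by (intro achievable_linear_filter achievable_product_filter achievable_site C m)
    then have "achievable (\<lambda>j. (of_real r * \<mu> j + of_real s) * P j * (\<psi> j m)\<^sup>2) (\<lambda>_. 0)"
      by (rule achievable_cong) (simp_all add: P_def \<mu>_def mult_ac)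
    then show ?thesis using Pj rs by (intro exI conjI) auto
  qed
  show ?thesis
  proof (cases "\<exists>j\<in>I. j \<noteq> i \<and> \<mu> j = \<mu> i")
    case False
    obtain f where f: "achievable f (\<lambda>_. 0)"
      "\<forall>j\<in>I. f j = (if \<mu> j = \<mu> i then w / (\<psi> i 1)\<^sup>2 * (\<psi> j 1)\<^sup>2 else 0)"
      using site[of 1 "w / (\<psi> i 1)\<^sup>2"] by auto
    then show ?thesis using nonzero[OF iE] i False by (intro exI[of _ f] exI[of _ "\<lambda>_. 0"]) auto
  next
    case True
    then obtain j where j: "j \<in> I" "j \<noteq> i" "\<mu> j = \<mu> i" by blast
    have only: "k = j" if "k \<in> I" "k \<noteq> i" "\<mu> k = \<mu> i" for k
      using resonance_pairs[of i k j] that j I iE by (auto simp: \<mu>_def)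
    obtain m n where mn: "m \<ge> 1" "n \<ge> 1" and ne: "(\<psi> i m)\<^sup>2 * (\<psi> j n)\<^sup>2 \<noteq> (\<psi> i n)\<^sup>2 * (\<psi> j m)\<^sup>2"
      using squares[of i j] j iE I by (auto simp: \<mu>_def)
    \<comment> \<open>The two profiles below solve the linear system with determinant \<open>D\<close> by Cramer's rule.\<close>
    define D where "D = (\<psi> i m)\<^sup>2 * (\<psi> j n)\<^sup>2 - (\<psi> i n)\<^sup>2 * (\<psi> j m)\<^sup>2"
    have D: "D \<noteq> 0" using ne by (auto simp: D_def)
    obtain f where f: "achievable f (\<lambda>_. 0)"
      "\<forall>k\<in>I. f k = (if \<mu> k = \<mu> i then w * (\<psi> j n)\<^sup>2 / D * (\<psi> k m)\<^sup>2 else 0)"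
      using site[OF mn(1)] by blast
    obtain f' where f': "achievable f' (\<lambda>_. 0)"
      "\<forall>k\<in>I. f' k = (if \<mu> k = \<mu> i then - w * (\<psi> j m)\<^sup>2 / D * (\<psi> k n)\<^sup>2 else 0)"
      using site[OF mn(2)] by blast
    let ?f = "\<lambda>k. of_real 1 * f k + of_real 1 * f' k"
    have "achievable ?f (\<lambda>_. 1 * 0 + 1 * 0)" by (rule achievable_lincomb[OF f(1) f'(1)])
    moreover have "?f i = w"
    proof -
      have "?f i = w * ((\<psi> i m)\<^sup>2 * (\<psi> j n)\<^sup>2 - (\<psi> i n)\<^sup>2 * (\<psi> j m)\<^sup>2) / D"
        using f(2) f'(2) i by (simp add: algebra_simps diff_divide_distrib)
      then show ?thesis using D by (simp add: D_def)
    qed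
    moreover have "?f k = 0" if "k \<in> I" "k \<noteq> i" for k
    proof (cases "\<mu> k = \<mu> i")
      case True
      then have "k = j" using only that by auto
      then show ?thesis using f(2) f'(2) j by (simp add: mult_ac)
    next
      case False
      then show ?thesis using f(2) f'(2) that by auto
    qed
    ultimately show ?thesis by (intro exI[of _ ?f] exI[of _ "\<lambda>_. 1 * 0 + 1 * 0"]) auto
  qed
qed

text \<open>
  Superposing isolating profiles with targets 1 and \<open>\<i>\<close> gives a linear right inverse; this is what makes the
  length \<open>l\<close> and the bound \<open>Q\<close> independent of the target \<open>w\<close>.
\<close>

lemma bounded_control:
  assumes I: "finite I" "I \<subseteq> E"
  shows "\<exists>l Q. l > 0 \<and> T dvd l \<and> Q > 0 \<and> (\<forall>w. (\<forall>i\<in>I. cmod (w i) \<le> M) \<longrightarrow>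
    (\<exists>d. (\<forall>n\<in>{1..l}. \<bar>d n\<bar> \<le> Q) \<and> (\<forall>i\<in>I. (\<Sum>n=1..l. of_real (d n) * (\<psi> i n)\<^sup>2) = w i \<and>
       (\<Sum>n=1..l. d n * (cmod (\<psi> i n))\<^sup>2) = (cmod (\<psi> i 1))\<^sup>2)))"
proof -
  obtain f g where fg: "achievable f g" "\<forall>i\<in>I. f i = 0 \<and> g i = (cmod (\<psi> i 1))\<^sup>2"
    using background_control[OF I] by blast
  obtain s L where "realizes s L f g"
    using fg(1) unfolding achievable_def by blast
  note s = realizesD[OF this]
  define good where "good i w p \<longleftrightarrow> (\<forall>L'\<ge>snd p. \<forall>j\<in>I.
     (\<Sum>n=1..L'. of_real (fst p n) * (\<psi> j n)\<^sup>2) = (if j = i then w else 0) \<and>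
     (\<Sum>n=1..L'. fst p n * (cmod (\<psi> j n))\<^sup>2) = 0)" for i w and p :: "(nat \<Rightarrow> real) \<times> nat"
  have ex: "\<exists>p. good i w p" if i: "i \<in> I" for i w
  proof -
    obtain f g where fg: "achievable f g" "f i = w" "\<forall>j\<in>I. j \<noteq> i \<longrightarrow> f j = 0" "\<forall>j\<in>I. g j = 0"
      using isolating_control[OF I i, of w] by blast
    obtain d L where "realizes d L f g"
      using fg(1) unfolding achievable_def by blast
    note d = realizesD[OF this]
    have "good i w (d, L)" unfolding good_def using d fg(2-4) I(2) by auto
    then show ?thesis by blast
  qed
  define pick where "pick i w = (SOME p. good i w p)" for i w
  have pick: "good i w (pick i w)" if "i \<in> I" for i w
    unfolding pick_def by (rule someI_ex[OF ex[OF that]])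
  \<comment> \<open>Profiles whose effects are 1 and \<open>\<i>\<close> span the complex targets over the reals.\<close>
  define d1 L1 where "d1 i = fst (pick i 1)" and "L1 i = snd (pick i 1)" for i
  define d2 L2 where "d2 i = fst (pick i \<i>)" and "L2 i = snd (pick i \<i>)" for i
  have d1: "(\<Sum>n=1..L'. of_real (d1 i n) * (\<psi> j n)\<^sup>2) = (if j = i then 1 else 0) \<and>
     (\<Sum>n=1..L'. d1 i n * (cmod (\<psi> j n))\<^sup>2) = 0" if "i \<in> I" "L' \<ge> L1 i" "j \<in> I" for i j L'
    using pick[OF that(1), of 1] that(2,3) unfolding good_def d1_def L1_def by auto
  have d2: "(\<Sum>n=1..L'. of_real (d2 i n) * (\<psi> j n)\<^sup>2) = (if j = i then \<i> else 0) \<and>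
     (\<Sum>n=1..L'. d2 i n * (cmod (\<psi> j n))\<^sup>2) = 0" if "i \<in> I" "L' \<ge> L2 i" "j \<in> I" for i j L'
    using pick[OF that(1), of \<i>] that(2,3) unfolding good_def d2_def L2_def by auto
  define l where "l = T * (1 + L + (\<Sum>i\<in>I. L1 i) + (\<Sum>i\<in>I. L2 i))"
  have big: "1 + L + (\<Sum>i\<in>I. L1 i) + (\<Sum>i\<in>I. L2 i) \<le> l"
    using mult_le_mono1[OF T_pos, of "1 + L + (\<Sum>i\<in>I. L1 i) + (\<Sum>i\<in>I. L2 i)"] unfolding l_def by simp
  have "L1 i \<le> l" "L2 i \<le> l" if "i \<in> I" for i
    using member_le_sum[of i I L1] member_le_sum[of i I L2] that I(1) big by auto
  moreover have "l > 0" "L \<le> l" using big by linarith+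
  ultimately have l: "l > 0" "L \<le> l" "\<And>i. i \<in> I \<Longrightarrow> L1 i \<le> l" "\<And>i. i \<in> I \<Longrightarrow> L2 i \<le> l"
    by blast+
  define Q where "Q = 1 + (\<Sum>n=1..l. \<bar>s n\<bar> + (\<Sum>i\<in>I. \<bar>M\<bar> * \<bar>d1 i n\<bar> + \<bar>M\<bar> * \<bar>d2 i n\<bar>))"
  have "Q > 0" unfolding Q_def by (intro add_pos_nonneg sum_nonneg add_nonneg_nonneg) auto
  have "\<exists>d. (\<forall>n\<in>{1..l}. \<bar>d n\<bar> \<le> Q) \<and> (\<forall>i\<in>I. (\<Sum>n=1..l. of_real (d n) * (\<psi> i n)\<^sup>2) = w i \<and>
       (\<Sum>n=1..l. d n * (cmod (\<psi> i n))\<^sup>2) = (cmod (\<psi> i 1))\<^sup>2)" if w: "\<forall>i\<in>I. cmod (w i) \<le> M" for w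
  proof -
    define d where "d n = s n + (\<Sum>i\<in>I. Re (w i) * d1 i n + Im (w i) * d2 i n)" for n
    have "\<bar>d n\<bar> \<le> Q" if "n \<in> {1..l}" for n
    proof -
      have "\<bar>d n\<bar> \<le> \<bar>s n\<bar> + \<bar>\<Sum>i\<in>I. Re (w i) * d1 i n + Im (w i) * d2 i n\<bar>"
        by (simp add: d_def abs_triangle_ineq)
      also have "\<bar>\<Sum>i\<in>I. Re (w i) * d1 i n + Im (w i) * d2 i n\<bar> \<le> (\<Sum>i\<in>I. \<bar>Re (w i) * d1 i n + Im (w i) * d2 i n\<bar>)"
        by (rule sum_abs)
      also have "\<dots> \<le> (\<Sum>i\<in>I. \<bar>M\<bar> * \<bar>d1 i n\<bar> + \<bar>M\<bar> * \<bar>d2 i n\<bar>)"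
      proof (rule sum_mono)
        fix i assume "i \<in> I"
        then have M: "\<bar>Re (w i)\<bar> \<le> \<bar>M\<bar>" "\<bar>Im (w i)\<bar> \<le> \<bar>M\<bar>"
          using w abs_Re_le_cmod[of "w i"] abs_Im_le_cmod[of "w i"] by fastforce+
        have "\<bar>Re (w i) * d1 i n + Im (w i) * d2 i n\<bar> \<le> \<bar>Re (w i)\<bar> * \<bar>d1 i n\<bar> + \<bar>Im (w i)\<bar> * \<bar>d2 i n\<bar>"
          by (simp add: abs_triangle_ineq flip: abs_mult)
        also have "\<dots> \<le> \<bar>M\<bar> * \<bar>d1 i n\<bar> + \<bar>M\<bar> * \<bar>d2 i n\<bar>"
          using M by (intro add_mono mult_right_mono) auto
        finally show "\<bar>Re (w i) * d1 i n + Im (w i) * d2 i n\<bar> \<le> \<bar>M\<bar> * \<bar>d1 i n\<bar> + \<bar>M\<bar> * \<bar>d2 i n\<bar>" .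
      qed
      finally have "\<bar>d n\<bar> \<le> \<bar>s n\<bar> + (\<Sum>i\<in>I. \<bar>M\<bar> * \<bar>d1 i n\<bar> + \<bar>M\<bar> * \<bar>d2 i n\<bar>)" by simp
      also have "\<dots> \<le> (\<Sum>n=1..l. \<bar>s n\<bar> + (\<Sum>i\<in>I. \<bar>M\<bar> * \<bar>d1 i n\<bar> + \<bar>M\<bar> * \<bar>d2 i n\<bar>))"
        using that by (intro member_le_sum[of n "{1..l}" "\<lambda>n. \<bar>s n\<bar> + (\<Sum>i\<in>I. \<bar>M\<bar> * \<bar>d1 i n\<bar> + \<bar>M\<bar> * \<bar>d2 i n\<bar>)"])
          (auto intro!: add_nonneg_nonneg sum_nonneg)
      finally show ?thesis by (simp add: Q_def)
    qed
    moreover have "(\<Sum>n=1..l. of_real (d n) * (\<psi> j n)\<^sup>2) = w j" if j: "j \<in> I" for j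
    proof -
      have "(\<Sum>n=1..l. of_real (d n) * (\<psi> j n)\<^sup>2) = (\<Sum>n=1..l. of_real (s n) * (\<psi> j n)\<^sup>2) +
         (\<Sum>n=1..l. \<Sum>i\<in>I. (of_real (Re (w i)) * of_real (d1 i n) + of_real (Im (w i)) * of_real (d2 i n)) * (\<psi> j n)\<^sup>2)"
        by (simp add: d_def distrib_right sum.distrib sum_distrib_right)
      also have "(\<Sum>n=1..l. \<Sum>i\<in>I. (of_real (Re (w i)) * of_real (d1 i n) + of_real (Im (w i)) * of_real (d2 i n)) * (\<psi> j n)\<^sup>2)
        = (\<Sum>i\<in>I. of_real (Re (w i)) * (\<Sum>n=1..l. of_real (d1 i n) * (\<psi> j n)\<^sup>2) + of_real (Im (w i)) * (\<Sum>n=1..l. of_real (d2 i n) * (\<psi> j n)\<^sup>2))"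
        by (subst sum.swap) (simp add: sum_distrib_left algebra_simps sum.distrib)
      also have "\<dots> = (\<Sum>i\<in>I. if i = j then w i else 0)"
      proof (intro sum.cong refl)
        fix i assume i: "i \<in> I"
        have "of_real (Re (w i)) + of_real (Im (w i)) * \<i> = w i" by (simp add: complex_eq_iff)
        then show "of_real (Re (w i)) * (\<Sum>n=1..l. of_real (d1 i n) * (\<psi> j n)\<^sup>2) + of_real (Im (w i)) * (\<Sum>n=1..l. of_real (d2 i n) * (\<psi> j n)\<^sup>2)
          = (if i = j then w i else 0)"
          using d1[OF i l(3)[OF i] j] d2[OF i l(4)[OF i] j] by auto
      qed
      also have "\<dots> = w j" using I(1) j by simp
      finally show ?thesis using s(1)[OF l(2), of j] fg(2) j I(2) by auto
    qed
    moreover have "(\<Sum>n=1..l. d n * (cmod (\<psi> j n))\<^sup>2) = (cmod (\<psi> j 1))\<^sup>2" if j: "j \<in> I" for j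
    proof -
      have "(\<Sum>n=1..l. d n * (cmod (\<psi> j n))\<^sup>2) = (\<Sum>n=1..l. s n * (cmod (\<psi> j n))\<^sup>2) +
         (\<Sum>n=1..l. \<Sum>i\<in>I. (Re (w i) * d1 i n + Im (w i) * d2 i n) * (cmod (\<psi> j n))\<^sup>2)"
        by (simp add: d_def distrib_right sum.distrib sum_distrib_right)
      also have "(\<Sum>n=1..l. \<Sum>i\<in>I. (Re (w i) * d1 i n + Im (w i) * d2 i n) * (cmod (\<psi> j n))\<^sup>2)
        = (\<Sum>i\<in>I. Re (w i) * (\<Sum>n=1..l. d1 i n * (cmod (\<psi> j n))\<^sup>2) + Im (w i) * (\<Sum>n=1..l. d2 i n * (cmod (\<psi> j n))\<^sup>2))"
        by (subst sum.swap) (simp add: sum_distrib_left algebra_simps sum.distrib)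
      also have "\<dots> = 0" using d1[OF _ l(3) j] d2[OF _ l(4) j] by simp
      finally show ?thesis using s(2)[OF l(2), of j] fg(2) j I(2) by auto
    qed
    ultimately show ?thesis by blast
  qed
  moreover have "T dvd l" by (simp add: l_def)
  ultimately show ?thesis using \<open>l > 0\<close> \<open>Q > 0\<close> by blast
qed

end

section \<open>A block that shrinks finitely many amplitudes\<close>

lemma finite_common_upper_bound:
  fixes f :: "'b \<Rightarrow> real"
  assumes "finite I"
  obtains C where "C > 0" "\<And>i. i \<in> I \<Longrightarrow> f i \<le> C"
proof
  have "f i \<le> 1 + (\<Sum>i\<in>I. \<bar>f i\<bar>)" if "i \<in> I" for i
    using member_le_sum[of i I "\<lambda>i. \<bar>f i\<bar>"] that assms by fastforce
  then show "\<And>i. i \<in> I \<Longrightarrow> f i \<le> 1 + (\<Sum>i\<in>I. \<bar>f i\<bar>)" .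
  show "1 + (\<Sum>i\<in>I. \<bar>f i\<bar>) > 0" by (intro add_pos_nonneg sum_nonneg) auto
qed

lemma finite_common_lower_bound:
  fixes f :: "'b \<Rightarrow> real"
  assumes "finite I" and "\<And>i. i \<in> I \<Longrightarrow> f i > 0"
  obtains c where "c > 0" "\<And>i. i \<in> I \<Longrightarrow> c \<le> f i"
proof -
  obtain C where C: "C > 0" "\<And>i. i \<in> I \<Longrightarrow> 1 / f i \<le> C"
    using finite_common_upper_bound[OF assms(1), of "\<lambda>i. 1 / f i"] by blast
  show ?thesis
  proof
    show "1 / C > 0" using C by simp
    show "1 / C \<le> f i" if "i \<in> I" for i
      using C(1) C(2)[OF that] assms(2)[OF that] by (simp add: field_simps)
  qed
qed

text \<open>
  The allowance \<open>1 / sqrt N - 1 / sqrt (N + l)\<close> for the drift of \<open>\<zeta>\<close> over a block telescopes, and it eventually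
  exceeds the second-order error \<open>C / N\<^sup>2\<close> for every constant \<open>C\<close>, however large a stage makes it.
\<close>

lemma inverse_square_le_sqrt_drop:
  "\<forall>\<^sub>F N in sequentially. C / (real N)\<^sup>2 \<le> 1 / sqrt (real N) - 1 / sqrt (real (N + 1))"
proof -
  have "\<forall>\<^sub>F N in sequentially. (\<bar>C\<bar> + 1) / (real N)\<^sup>2 \<le> 1 / sqrt (real N) - 1 / sqrt (real N + 1)"
  proof -
    have "D > 0 \<Longrightarrow> \<forall>\<^sub>F N in sequentially. D / (real N)\<^sup>2 \<le> 1 / sqrt (real N) - 1 / sqrt (real N + 1)" for D :: real
      by real_asymp
    from this[of "\<bar>C\<bar> + 1"] show ?thesis by simp
  qed
  then show ?thesis
  proof (rule eventually_mono)
    fix N :: nat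
    assume "(\<bar>C\<bar> + 1) / (real N)\<^sup>2 \<le> 1 / sqrt (real N) - 1 / sqrt (real N + 1)"
    moreover have "C / (real N)\<^sup>2 \<le> (\<bar>C\<bar> + 1) / (real N)\<^sup>2" by (intro divide_right_mono) auto
    ultimately show "C / (real N)\<^sup>2 \<le> 1 / sqrt (real N) - 1 / sqrt (real (N + 1))" by (simp add: add.commute)
  qed
qed

context floquet_family
begin

lemma shift_multiple:
  assumes "i \<in> E"
  shows "\<psi> i (T * k + n) = \<tau> i ^ k * \<psi> i n"
proof (induction k)
  case (Suc k)
  have "\<psi> i (T * Suc k + n) = \<psi> i (T * k + n + T)" by (simp add: algebra_simps)
  then show ?case using shift[OF assms] Suc by simp
qed simp

lemma bounded:
  assumes "i \<in> E"
  shows "\<exists>B>0. \<forall>n. cmod (\<psi> i n) \<le> B"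
  using floquet_bounded[of T "\<tau> i" "\<psi> i"] T_pos unit[OF assms] shift[OF assms] by blast

text \<open>
  For the energies in \<open>I\<close> one block shrinks all amplitudes by the factor \<open>N / (N + l)\<close>, together with the
  amplitudes for \<open>- \<omega> i\<close> with \<open>i\<close> in \<open>P\<close>. The target for \<open>F i\<close> depends on the current phase of the amplitude
  and on \<open>\<zeta>\<close>, so the potential is a feedback. The constants \<open>l\<close> and \<open>N\<^sub>0\<close> are uniform because the targets
  stay bounded while \<open>\<zeta>\<close> is in its ball.
\<close>

lemma block_controls_exist:
  fixes P :: "nat set" and \<zeta>\<^sub>0 :: "nat \<Rightarrow> complex" and \<rho> :: real and K :: "nat \<Rightarrow> real"
  assumes I: "finite I" "I \<subseteq> E" and P: "P \<subseteq> I" and \<rho>: "\<rho> > 0"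
    and cone: "\<And>i. i \<in> P \<Longrightarrow> 2 * \<rho> \<le> Re (\<zeta>\<^sub>0 i) \<and> 2 * \<rho> \<le> \<bar>Im (\<zeta>\<^sub>0 i)\<bar> \<and> \<omega> i * Im (\<zeta>\<^sub>0 i) < 0"
    and K: "filterlim K at_top sequentially"
  shows "\<exists>l N\<^sub>0. l > 0 \<and> T dvd l \<and> (\<forall>N q\<^sub>0. N \<ge> N\<^sub>0 \<and> T dvd N \<and>
     (\<forall>i\<in>P. cmod (amplitude_ratio (\<omega> i) (\<psi> i) q\<^sub>0 N - \<zeta>\<^sub>0 i) \<le> \<rho>) \<longrightarrow>
     (\<exists>q. (\<forall>n\<le>N. q n = q\<^sub>0 n) \<and> (\<forall>n\<in>{N<..N+l}. \<bar>q n\<bar> \<le> K n / real n) \<and>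
        (\<forall>i\<in>I. contracts (\<omega> i) (\<psi> i) q N l) \<and> (\<forall>i\<in>P. contracts (- \<omega> i) (\<psi> i) q N l) \<and>
        (\<forall>i\<in>P. cmod (amplitude_ratio (\<omega> i) (\<psi> i) q (N + l) - amplitude_ratio (\<omega> i) (\<psi> i) q N)
            \<le> 1 / sqrt N - 1 / sqrt (N + l))))"
proof -
  define g where "g i = (cmod (\<psi> i 1))\<^sup>2" for i
  have g: "g i > 0" if "i \<in> E" for i using nonzero(1)[OF that, of 1] by (simp add: g_def)
  define Z where "Z i = cmod (\<zeta>\<^sub>0 i) + \<rho>" for i
  have Z: "Z i > 0" for i using \<rho> by (simp add: Z_def add_nonneg_pos)
  have IE: "i \<in> E" if "i \<in> I" for i using that I by auto
  \<comment> \<open>For \<open>i\<close> in \<open>P\<close> this solves \<open>G = - 2 \<omega> r * Re \<zeta> / Im \<zeta>\<close> with \<open>G = g i\<close>, the mean part that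
    \<open>bounded_control\<close> supplies. All other amplitudes can shrink at any rate.\<close>
  define rate where "rate i \<zeta> = (if i \<in> P then - g i * Im \<zeta> / (2 * \<omega> i * Re \<zeta>) else 1)" for i \<zeta>
  define lo hi where "lo i = min 1 (g i * \<rho> / (2 * \<bar>\<omega> i\<bar> * Z i))"
    and "hi i = max 1 (g i * Z i / (2 * \<bar>\<omega> i\<bar> * \<rho>))" for i
  have ball: "Re \<zeta> \<ge> \<rho> \<and> \<bar>Im \<zeta>\<bar> \<ge> \<rho> \<and> \<omega> i * Im \<zeta> < 0 \<and> Re \<zeta> \<le> Z i \<and> \<bar>Im \<zeta>\<bar> \<le> Z i \<and> cmod \<zeta> \<le> Z i"
    if i: "i \<in> P" and b: "cmod (\<zeta> - \<zeta>\<^sub>0 i) \<le> \<rho>" for i \<zeta>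
  proof -
    have re: "\<bar>Re \<zeta> - Re (\<zeta>\<^sub>0 i)\<bar> \<le> \<rho>" and im: "\<bar>Im \<zeta> - Im (\<zeta>\<^sub>0 i)\<bar> \<le> \<rho>"
      using abs_Re_le_cmod[of "\<zeta> - \<zeta>\<^sub>0 i"] abs_Im_le_cmod[of "\<zeta> - \<zeta>\<^sub>0 i"] b by auto
    have nz: "cmod \<zeta> \<le> Z i" using norm_triangle_sub[of \<zeta> "\<zeta>\<^sub>0 i"] b by (simp add: Z_def)
    have s: "\<omega> i * Im \<zeta> < 0"
    proof (cases "\<omega> i > 0")
      case True
      then have "Im (\<zeta>\<^sub>0 i) < 0" using cone[OF i] by (simp add: mult_less_0_iff)
      then have "Im \<zeta> < 0" using cone[OF i] im \<rho> by linarith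
      then show ?thesis using True by (simp add: mult_less_0_iff)
    next
      case False
      then have w: "\<omega> i < 0" using cone[OF i] by (auto simp: mult_less_0_iff)
      then have "Im (\<zeta>\<^sub>0 i) > 0" using cone[OF i] by (simp add: mult_less_0_iff)
      then have "Im \<zeta> > 0" using cone[OF i] im \<rho> by linarith
      then show ?thesis using w by (simp add: mult_less_0_iff)
    qed
    have "Re \<zeta> \<ge> \<rho>" "\<bar>Im \<zeta>\<bar> \<ge> \<rho>" using cone[OF i] re im by linarith+
    then show ?thesis using s nz abs_Re_le_cmod[of \<zeta>] abs_Im_le_cmod[of \<zeta>] by auto
  qed
  have lo: "lo i > 0" if "i \<in> I" for i
    using g[OF IE[OF that]] nonzero(2)[OF IE[OF that]] \<rho> Z[of i] by (simp add: lo_def)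
  have rate: "lo i \<le> rate i \<zeta> \<and> rate i \<zeta> \<le> hi i"
    if i: "i \<in> I" and b: "i \<in> P \<Longrightarrow> cmod (\<zeta> - \<zeta>\<^sub>0 i) \<le> \<rho>" for i \<zeta>
  proof (cases "i \<in> P")
    case True
    note bb = ball[OF True b[OF True]]
    have om: "\<omega> i \<noteq> 0" by (rule nonzero(2)[OF IE[OF i]])
    have gi: "g i > 0" using g IE i by simp
    have "rate i \<zeta> = g i * \<bar>Im \<zeta>\<bar> / (2 * \<bar>\<omega> i\<bar> * Re \<zeta>)"
    proof -
      have "Im \<zeta> / \<omega> i < 0" using bb by (auto simp: divide_less_0_iff mult_less_0_iff)
      then have "- (Im \<zeta> / \<omega> i) = \<bar>Im \<zeta>\<bar> / \<bar>\<omega> i\<bar>" by (simp flip: abs_divide)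
      moreover have "rate i \<zeta> = g i * (- (Im \<zeta> / \<omega> i)) / (2 * Re \<zeta>)"
        using True by (simp add: rate_def mult_ac)
      ultimately show ?thesis by (simp add: mult_ac)
    qed
    moreover have "g i * \<rho> / (2 * \<bar>\<omega> i\<bar> * Z i) \<le> g i * \<bar>Im \<zeta>\<bar> / (2 * \<bar>\<omega> i\<bar> * Re \<zeta>)"
      using bb \<rho> gi om Z[of i] by (intro frac_le mult_left_mono mult_pos_pos) auto
    moreover have "g i * \<bar>Im \<zeta>\<bar> / (2 * \<bar>\<omega> i\<bar> * Re \<zeta>) \<le> g i * Z i / (2 * \<bar>\<omega> i\<bar> * \<rho>)"
      using bb \<rho> gi om Z[of i] by (intro frac_le mult_left_mono mult_pos_pos) auto
    ultimately show ?thesis unfolding lo_def hi_def by (metis max.coboundedI2 min.coboundedI2)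
  qed (auto simp: rate_def lo_def hi_def)
  obtain rmin where rmin: "rmin > 0" "\<And>i. i \<in> I \<Longrightarrow> rmin \<le> lo i"
    using finite_common_lower_bound[of I lo] I(1) lo by blast
  obtain rmax where rmax: "rmax > 0" "\<And>i. i \<in> I \<Longrightarrow> hi i \<le> rmax"
    using finite_common_upper_bound[of I hi] I(1) by blast
  \<comment> \<open>\<open>M\<close> bounds the targets: they have modulus at most \<open>|2 \<i> \<omega> r - g|\<close>.\<close>
  obtain M where M: "M > 0" "\<And>i. i \<in> I \<Longrightarrow> 2 * \<bar>\<omega> i\<bar> * rmax + g i \<le> M"
    using finite_common_upper_bound[OF I(1), of "\<lambda>i. 2 * \<bar>\<omega> i\<bar> * rmax + g i"] by blast
  obtain Zm where Zm: "Zm > 0" "\<And>i. i \<in> I \<Longrightarrow> Z i \<le> Zm"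
    using finite_common_upper_bound[of I Z] I(1) by blast
  obtain B where B: "\<And>i n. i \<in> I \<Longrightarrow> cmod (\<psi> i n) \<le> B i" using bounded IE by metis
  have "\<exists>l Q. l > 0 \<and> T dvd l \<and> Q > 0 \<and> (\<forall>w. (\<forall>i\<in>I. cmod (w i) \<le> M) \<longrightarrow>
    (\<exists>d. (\<forall>n\<in>{1..l}. \<bar>d n\<bar> \<le> Q) \<and> (\<forall>i\<in>I. (\<Sum>n=1..l. of_real (d n) * (\<psi> i n)\<^sup>2) = w i \<and>
       (\<Sum>n=1..l. d n * (cmod (\<psi> i n))\<^sup>2) = g i)))"
    unfolding g_def by (rule bounded_control[OF I])
  then obtain l Q where lQ: "l > 0 \<and> T dvd l \<and> Q > 0 \<and> (\<forall>w. (\<forall>i\<in>I. cmod (w i) \<le> M) \<longrightarrow>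
    (\<exists>d. (\<forall>n\<in>{1..l}. \<bar>d n\<bar> \<le> Q) \<and> (\<forall>i\<in>I. (\<Sum>n=1..l. of_real (d n) * (\<psi> i n)\<^sup>2) = w i \<and>
       (\<Sum>n=1..l. d n * (cmod (\<psi> i n))\<^sup>2) = g i)))"
    by (elim exE) (rule that)
  then have l: "l > 0" "T dvd l" and Q: "Q > 0" by simp_all
  note ctrl = lQ[THEN conjunct2, THEN conjunct2, THEN conjunct2, rule_format]
  obtain A where A: "A > 0" "\<And>i. i \<in> I \<Longrightarrow> real l * Q * (B i)\<^sup>2 / \<bar>\<omega> i\<bar> \<le> A"
    using finite_common_upper_bound[OF I(1), of "\<lambda>i. real l * Q * (B i)\<^sup>2 / \<bar>\<omega> i\<bar>"] by blast
  define \<epsilon> where "\<epsilon> N = 2 * real l / (rmin * real (N + l))" for N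
  have \<epsilon>_lim: "\<epsilon> \<longlonglongrightarrow> 0" unfolding \<epsilon>_def using l(1) rmin(1) by real_asymp
  have ev_small: "\<forall>\<^sub>F N in sequentially. \<epsilon> N < c" if "c > 0" for c
    using order_tendstoD(2)[OF \<epsilon>_lim that] .
  \<comment> \<open>The bounds on \<open>\<epsilon>\<close> mean that the block error estimate applies, that its error is at most half of the
    gain, and that no amplitude loses more than a factor 4, which limits the drift of \<open>\<zeta>\<close>.\<close>
  define c0 where "c0 = min (min (1 / A) (rmin / (2 * A\<^sup>2))) (min (1 / (2 * rmax)) (1 / (2 * A)))"
  have c0: "c0 > 0" using A rmin rmax by (simp add: c0_def)
  have "\<forall>\<^sub>F N in sequentially. \<epsilon> N < c0 \<and>
     32 * A\<^sup>2 * (real l)\<^sup>2 * Zm / rmin\<^sup>2 / (real N)\<^sup>2 \<le> 1 / sqrt (real N) - 1 / sqrt (real (N + 1)) \<and>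
     2 * real l * Q / rmin \<le> K N \<and> N > 0"
    by (intro eventually_conj ev_small c0 inverse_square_le_sqrt_drop eventually_gt_at_top
        K[unfolded filterlim_at_top, rule_format])
  then obtain N\<^sub>0 where N0: "\<And>N. N \<ge> N\<^sub>0 \<Longrightarrow> \<epsilon> N < c0"
     "\<And>N. N \<ge> N\<^sub>0 \<Longrightarrow> 32 * A\<^sup>2 * (real l)\<^sup>2 * Zm / rmin\<^sup>2 / (real N)\<^sup>2 \<le> 1 / sqrt (real N) - 1 / sqrt (real (N + 1))"
     "\<And>N. N \<ge> N\<^sub>0 \<Longrightarrow> 2 * real l * Q / rmin \<le> K N" "\<And>N. N \<ge> N\<^sub>0 \<Longrightarrow> N > 0"
    unfolding eventually_sequentially by blast
  have main: "\<exists>q. (\<forall>n\<le>N. q n = q\<^sub>0 n) \<and> (\<forall>n\<in>{N<..N+l}. \<bar>q n\<bar> \<le> K n / real n) \<and>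
        (\<forall>i\<in>I. contracts (\<omega> i) (\<psi> i) q N l) \<and> (\<forall>i\<in>P. contracts (- \<omega> i) (\<psi> i) q N l) \<and>
        (\<forall>i\<in>P. cmod (amplitude_ratio (\<omega> i) (\<psi> i) q (N + l) - amplitude_ratio (\<omega> i) (\<psi> i) q N)
            \<le> 1 / sqrt N - 1 / sqrt (N + l))"
    if N: "N \<ge> N\<^sub>0" "T dvd N"
      and near: "\<And>i. i \<in> P \<Longrightarrow> cmod (amplitude_ratio (\<omega> i) (\<psi> i) q\<^sub>0 N - \<zeta>\<^sub>0 i) \<le> \<rho>" for N q\<^sub>0
  proof -
    define e where "e = \<epsilon> N"
    have Npos: "N > 0" using N0(4) N by simp
    have e0: "e > 0" using l rmin Npos by (simp add: e_def \<epsilon>_def)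
    have "e < c0" using N0(1) N by (simp add: e_def)
    then have e1: "e < 1 / A" "e < rmin / (2 * A\<^sup>2)" "e < 1 / (2 * rmax)" "e < 1 / (2 * A)"
      by (auto simp: c0_def)
    have Ae: "A * e \<le> 1" using e1(1) A(1) by (simp add: field_simps)
    have Ae2: "A * e \<le> 1 / 2" using e1(4) A(1) by (simp add: field_simps)
    have er: "e * rmax \<le> 1 / 2" using e1(3) rmax(1) by (simp add: field_simps)
    have A2e: "A\<^sup>2 * e \<le> rmin / 2" using e1(2) A(1) by (simp add: field_simps)
    have A2e2: "A\<^sup>2 * e\<^sup>2 \<le> 1 / 4"
    proof -
      have "(A * e)\<^sup>2 \<le> (1 / 2)\<^sup>2" using Ae2 A(1) e0 by (intro power_mono) auto
      then show ?thesis by (simp add: power2_eq_square mult_ac)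
    qed
    obtain k where k: "N = T * k" using N(2) by blast
    define z where "z i = amplitude (\<omega> i) (\<psi> i) q\<^sub>0 N" for i
    define \<zeta> where "\<zeta> i = amplitude_ratio (\<omega> i) (\<psi> i) q\<^sub>0 N" for i
    define r where "r i = rate i (\<zeta> i)" for i
    have r: "rmin \<le> r i" "r i \<le> rmax" if "i \<in> I" for i
      using rate[OF that, of "\<zeta> i"] near[of i] rmin(2)[OF that] rmax(2)[OF that] by (auto simp: r_def \<zeta>_def)
    \<comment> \<open>As \<open>sgn z\<^sup>2 * cnj z = z\<close>, this \<open>F\<close> turns \<open>g z + cnj F * cnj z\<close> into \<open>2 \<i> \<omega> r z\<close>.\<close>
    define F where "F i = cnj ((2 * \<i> * of_real (\<omega> i * r i) - of_real (g i)) * (sgn (z i))\<^sup>2)" for i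
    \<comment> \<open>A block that starts at \<open>N = T k\<close> sees \<open>\<psi>\<close> multiplied by \<open>\<tau> ^ k\<close>.\<close>
    define w where "w i = F i / (\<tau> i ^ k)\<^sup>2" for i
    have "cmod (w i) \<le> M" if "i \<in> I" for i
    proof -
      have "cmod (w i) = cmod (2 * \<i> * of_real (\<omega> i * r i) - of_real (g i)) * (cmod (sgn (z i)))\<^sup>2"
        by (simp only: w_def F_def norm_divide complex_mod_cnj norm_mult norm_power unit[OF IE[OF that]] power_one div_by_1)
      also have "\<dots> \<le> (2 * \<bar>\<omega> i\<bar> * rmax + g i) * 1"
      proof (intro mult_mono)
        have "cmod (2 * \<i> * of_real (\<omega> i * r i) - of_real (g i)) \<le>
            cmod (2 * \<i> * of_real (\<omega> i * r i)) + cmod (of_real (g i))" by (rule norm_triangle_ineq4)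
        also have "\<dots> = 2 * \<bar>\<omega> i\<bar> * r i + g i"
          using r[OF that] rmin(1) g[OF IE[OF that]] by (simp add: norm_mult abs_mult)
        also have "\<dots> \<le> 2 * \<bar>\<omega> i\<bar> * rmax + g i" using r[OF that] by (simp add: mult_left_mono)
        finally show "cmod (2 * \<i> * of_real (\<omega> i * r i) - of_real (g i)) \<le> 2 * \<bar>\<omega> i\<bar> * rmax + g i" .
        show "(cmod (sgn (z i)))\<^sup>2 \<le> 1" by (simp add: norm_sgn)
        show "0 \<le> 2 * \<bar>\<omega> i\<bar> * rmax + g i" using rmax(1) g[OF IE[OF that]] by simp
      qed simp
      finally show ?thesis using M(2)[OF that] by simp
    qed
    then have "\<exists>d. (\<forall>n\<in>{1..l}. \<bar>d n\<bar> \<le> Q) \<and> (\<forall>i\<in>I. (\<Sum>n=1..l. of_real (d n) * (\<psi> i n)\<^sup>2) = w i \<and>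
       (\<Sum>n=1..l. d n * (cmod (\<psi> i n))\<^sup>2) = g i)" by (rule ctrl)
    then obtain d where d': "(\<forall>n\<in>{1..l}. \<bar>d n\<bar> \<le> Q) \<and> (\<forall>i\<in>I. (\<Sum>n=1..l. of_real (d n) * (\<psi> i n)\<^sup>2) = w i \<and>
       (\<Sum>n=1..l. d n * (cmod (\<psi> i n))\<^sup>2) = g i)" by (elim exE) (rule that)
    have d: "\<forall>n\<in>{1..l}. \<bar>d n\<bar> \<le> Q"
      "\<And>i. i \<in> I \<Longrightarrow> (\<Sum>n=1..l. of_real (d n) * (\<psi> i n)\<^sup>2) = w i"
      "\<And>i. i \<in> I \<Longrightarrow> (\<Sum>n=1..l. d n * (cmod (\<psi> i n))\<^sup>2) = g i" using d' by simp_all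
    define q where "q n = (if n \<le> N then q\<^sub>0 n else e * d (n - N))" for n
    have qN: "amplitude om \<phi> q N = amplitude om \<phi> q\<^sub>0 N" for om \<phi>
      by (rule amplitude_cong) (simp add: q_def)
    have qk: "\<forall>k\<in>{1..l}. q (N + k) = e * d k" by (simp add: q_def)
    have Fsum: "(\<Sum>n=1..l. of_real (d n) * (\<psi> i (N + n))\<^sup>2) = F i" if i: "i \<in> I" for i
    proof -
      have "\<tau> i \<noteq> 0" using unit[OF IE[OF i]] by auto
      have "(\<Sum>n=1..l. of_real (d n) * (\<psi> i (N + n))\<^sup>2) = (\<tau> i ^ k)\<^sup>2 * (\<Sum>n=1..l. of_real (d n) * (\<psi> i n)\<^sup>2)"
        unfolding k sum_distrib_left using shift_multiple[OF IE[OF i]] by (intro sum.cong) (auto simp: power_mult_distrib)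
      also have "\<dots> = F i" using d(2)[OF i] \<open>\<tau> i \<noteq> 0\<close> by (simp add: w_def)
      finally show ?thesis .
    qed
    have Gsum: "(\<Sum>n=1..l. d n * (cmod (\<psi> i (N + n)))\<^sup>2) = g i" if i: "i \<in> I" for i
    proof -
      have "cmod (\<psi> i (N + n)) = cmod (\<psi> i n)" for n
        unfolding k using shift_multiple[OF IE[OF i]] unit[OF IE[OF i]] by (simp add: norm_mult norm_power)
      then show ?thesis using d(3)[OF i] by simp
    qed
    have cnjF: "cnj (F i) * cnj (z i) = (2 * \<i> * of_real (\<omega> i * r i) - of_real (g i)) * z i" for i
    proof -
      have "(sgn (z i))\<^sup>2 * cnj (z i) = z i"
      proof (cases "z i = 0")
        case False
        have "(sgn (z i))\<^sup>2 * cnj (z i) = z i * (z i * cnj (z i)) / (of_real (cmod (z i)))\<^sup>2"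
          by (simp add: sgn_div_norm scaleR_conv_of_real power2_eq_square field_simps)
        also have "z i * cnj (z i) = (of_real (cmod (z i)))\<^sup>2" by (simp flip: complex_norm_square)
        finally show ?thesis using False by simp
      qed simp
      then show ?thesis by (simp add: F_def mult.assoc)
    qed
    have tz: "of_real (g i) * z i + cnj (F i) * cnj (z i) = 2 * \<i> * of_real (\<omega> i * r i) * z i" for i
      unfolding cnjF by (simp add: algebra_simps)
    have wz: "amplitude (- \<omega> i) (\<psi> i) q\<^sub>0 N = \<zeta> i * z i" if "i \<in> I" for i
      using amplitude_nonzero[of "\<psi> i"] nonzero(1)[OF IE[OF that], of 0] by (simp add: \<zeta>_def z_def amplitude_ratio_def)
    have tw: "of_real (g i) * (\<zeta> i * z i) + cnj (F i) * cnj (\<zeta> i * z i) = 2 * \<i> * of_real (- \<omega> i * r i) * (\<zeta> i * z i)"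
      if i: "i \<in> P" for i
    proof -
      have "Re (\<zeta> i) \<noteq> 0" using ball[OF i near[OF i]] \<rho> by (auto simp: \<zeta>_def)
      then have "2 * \<omega> i * r i * Re (\<zeta> i) = - g i * Im (\<zeta> i)"
        using i P nonzero(2)[OF IE, of i] by (auto simp: r_def rate_def field_simps)
      then have balance: "of_real (g i) * \<zeta> i + (2 * \<i> * of_real (\<omega> i * r i) - of_real (g i)) * cnj (\<zeta> i)
          = 2 * \<i> * of_real (- \<omega> i * r i) * \<zeta> i"
        by (simp add: complex_eq_iff algebra_simps)
      have partner: "cnj (F i) * cnj (\<zeta> i * z i) = (2 * \<i> * of_real (\<omega> i * r i) - of_real (g i)) * z i * cnj (\<zeta> i)"
        unfolding cnjF[symmetric] complex_cnj_mult by (simp only: mult_ac)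
      have "of_real (g i) * (\<zeta> i * z i) + cnj (F i) * cnj (\<zeta> i * z i)
          = (of_real (g i) * \<zeta> i + (2 * \<i> * of_real (\<omega> i * r i) - of_real (g i)) * cnj (\<zeta> i)) * z i"
        unfolding partner by (simp only: distrib_left distrib_right mult_ac)
      also have "\<dots> = 2 * \<i> * of_real (- \<omega> i * r i) * (\<zeta> i * z i)"
        unfolding balance by (simp only: mult.assoc)
      finally show ?thesis .
    qed
    have blk: "cmod (amplitude om (\<psi> i) q (N + l) - of_real (1 - e * r i) * amplitude om (\<psi> i) q N)
         \<le> A\<^sup>2 * e\<^sup>2 * cmod (amplitude om (\<psi> i) q N)"
      "\<And>j. j \<le> l \<Longrightarrow> cmod (amplitude om (\<psi> i) q (N + j)) \<le> 3 * cmod (amplitude om (\<psi> i) q N)"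
      if i: "i \<in> I" and om: "\<bar>om\<bar> = \<bar>\<omega> i\<bar>"
        and t: "of_real (g i) * amplitude om (\<psi> i) q\<^sub>0 N + cnj (F i) * cnj (amplitude om (\<psi> i) q\<^sub>0 N) =
           2 * \<i> * of_real (om * r i) * amplitude om (\<psi> i) q\<^sub>0 N" for i om
    proof -
      have om0: "om \<noteq> 0" using nonzero(2)[OF IE[OF i]] om by auto
      note cb = controlled_block[where q = q and d = d and \<phi> = "\<psi> i" and \<omega> = om and N = N and l = l and r = "r i",
          OF om0 B[OF i] less_imp_le[OF e0] qk d(1) A(2)[OF i, folded om] Ae l(1) Fsum[OF i] Gsum[OF i], unfolded qN, OF t]
      show "cmod (amplitude om (\<psi> i) q (N + l) - of_real (1 - e * r i) * amplitude om (\<psi> i) q N)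
         \<le> A\<^sup>2 * e\<^sup>2 * cmod (amplitude om (\<psi> i) q N)" unfolding qN using cb(1) by blast
      show "\<And>j. j \<le> l \<Longrightarrow> cmod (amplitude om (\<psi> i) q (N + j)) \<le> 3 * cmod (amplitude om (\<psi> i) q N)"
        unfolding qN using cb(2) by blast
    qed
    have erange: "0 \<le> 1 - e * r i" "1 - e * r i \<le> 1 - e * rmin" "1 - e * r i \<ge> 1 / 2" if "i \<in> I" for i
    proof -
      have "e * r i \<le> e * rmax" "e * rmin \<le> e * r i" using r[OF that] e0 by (auto intro: mult_left_mono)
      then show "0 \<le> 1 - e * r i" "1 - e * r i \<le> 1 - e * rmin" "1 - e * r i \<ge> 1 / 2" using er by linarith+
    qed
    have contr: "contracts om (\<psi> i) q N l"
      if i: "i \<in> I" and om: "\<bar>om\<bar> = \<bar>\<omega> i\<bar>"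
        and t: "of_real (g i) * amplitude om (\<psi> i) q\<^sub>0 N + cnj (F i) * cnj (amplitude om (\<psi> i) q\<^sub>0 N) =
           2 * \<i> * of_real (om * r i) * amplitude om (\<psi> i) q\<^sub>0 N" for i om
    proof -
      let ?v = "amplitude om (\<psi> i) q N"
      have "cmod (amplitude om (\<psi> i) q (N + l)) \<le> cmod (of_real (1 - e * r i) * ?v)
         + cmod (amplitude om (\<psi> i) q (N + l) - of_real (1 - e * r i) * ?v)" by (rule norm_triangle_sub)
      also have "\<dots> \<le> (1 - e * r i) * cmod ?v + A\<^sup>2 * e\<^sup>2 * cmod ?v"
        using blk(1)[OF that] erange(1)[OF i] by (intro add_mono) (simp_all add: norm_mult del: of_real_diff of_real_mult)
      also have "\<dots> = (1 - e * r i + A\<^sup>2 * e\<^sup>2) * cmod ?v" by (simp add: algebra_simps)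
      also have "\<dots> \<le> (1 - e * rmin / 2) * cmod ?v"
      proof (rule mult_right_mono)
        have "A\<^sup>2 * e\<^sup>2 \<le> rmin / 2 * e" using mult_right_mono[OF A2e less_imp_le[OF e0]] by (simp add: power2_eq_square mult_ac)
        then show "1 - e * r i + A\<^sup>2 * e\<^sup>2 \<le> 1 - e * rmin / 2" using erange(2)[OF i] by (simp add: mult_ac)
      qed simp
      also have "1 - e * rmin / 2 = real N / real (N + l)"
      proof -
        have "e * rmin / 2 = real l / real (N + l)" using rmin(1) l(1) by (simp add: e_def \<epsilon>_def divide_simps)
        then show ?thesis using l(1) by (simp add: divide_simps) (simp add: algebra_simps)
      qed
      finally have "real (N + l) * cmod (amplitude om (\<psi> i) q (N + l)) \<le> real N * cmod ?v"
        using l(1) by (simp add: field_simps)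
      then show ?thesis using blk(2)[OF that] by (simp add: contracts_def)
    qed
    have c1: "\<forall>i\<in>I. contracts (\<omega> i) (\<psi> i) q N l" using contr[OF _ refl] tz by (simp add: z_def)
    have twP: "of_real (g i) * amplitude (- \<omega> i) (\<psi> i) q\<^sub>0 N + cnj (F i) * cnj (amplitude (- \<omega> i) (\<psi> i) q\<^sub>0 N) =
           2 * \<i> * of_real (- \<omega> i * r i) * amplitude (- \<omega> i) (\<psi> i) q\<^sub>0 N" if "i \<in> P" for i
      using tw[OF that] wz[of i] that P by auto
    have c2: "\<forall>i\<in>P. contracts (- \<omega> i) (\<psi> i) q N l"
      using contr[OF _ _ twP] P by auto
    have bound: "\<bar>q n\<bar> \<le> K n / real n" if "n \<in> {N<..N+l}" for n
    proof -
      have n: "n > 0" "n \<le> N + l" "n - N \<in> {1..l}" using that by auto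
      have "\<bar>q n\<bar> = e * \<bar>d (n - N)\<bar>" using that e0 by (simp add: q_def abs_mult)
      also have "\<dots> \<le> e * Q" using d(1) n(3) e0 by (intro mult_left_mono) auto
      also have "\<dots> = 2 * real l * Q / rmin / real (N + l)" using rmin(1) by (simp add: e_def \<epsilon>_def field_simps)
      also have "\<dots> \<le> 2 * real l * Q / rmin / real n"
        using n Q rmin(1) by (intro divide_left_mono mult_pos_pos) auto
      also have "\<dots> \<le> K n / real n" using N0(3)[of n] N(1) that by (intro divide_right_mono) auto
      finally show ?thesis .
    qed
    have drift: "cmod (amplitude_ratio (\<omega> i) (\<psi> i) q (N + l) - amplitude_ratio (\<omega> i) (\<psi> i) q N)
            \<le> 1 / sqrt N - 1 / sqrt (N + l)" if i: "i \<in> P" for i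
    proof -
      have iI: "i \<in> I" using i P by auto
      let ?z = "amplitude (\<omega> i) (\<psi> i) q N" and ?z' = "amplitude (\<omega> i) (\<psi> i) q (N + l)"
      let ?w = "amplitude (- \<omega> i) (\<psi> i) q N" and ?w' = "amplitude (- \<omega> i) (\<psi> i) q (N + l)"
      let ?c = "complex_of_real (1 - e * r i)"
      have z0: "?z \<noteq> 0" "?z' \<noteq> 0" using amplitude_nonzero[of "\<psi> i"] nonzero(1)[OF IE[OF iI], of 0] by auto
      have "?w = \<zeta> i * ?z" using wz[OF iI] by (simp add: qN z_def)
      have bz: "cmod (?z' - ?c * ?z) \<le> A\<^sup>2 * e\<^sup>2 * cmod ?z"
        using blk(1)[OF iI refl] tz by (simp add: z_def)
      have bw: "cmod (?w' - ?c * ?w) \<le> A\<^sup>2 * e\<^sup>2 * cmod ?w" using blk(1)[OF iI _ twP[OF i]] by simp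
      have "cmod (?c * ?z) \<le> cmod ?z' + cmod (?z' - ?c * ?z)" using norm_triangle_sub[of "?c * ?z" ?z'] by (simp add: norm_minus_commute)
      moreover have "cmod (?c * ?z) \<ge> 1 / 2 * cmod ?z"
        unfolding norm_mult norm_of_real using erange(3)[OF iI] by (intro mult_right_mono) auto
      moreover have "A\<^sup>2 * e\<^sup>2 * cmod ?z \<le> 1 / 4 * cmod ?z" using A2e2 by (intro mult_right_mono) auto
      ultimately have lower: "cmod ?z' \<ge> cmod ?z / 4" using bz by linarith
      have num: "amplitude_ratio (\<omega> i) (\<psi> i) q (N + l) - amplitude_ratio (\<omega> i) (\<psi> i) q N
         = ((?w' - ?c * ?w) - \<zeta> i * (?z' - ?c * ?z)) / ?z'"
        using z0 by (simp add: amplitude_ratio_def \<open>?w = \<zeta> i * ?z\<close> field_simps)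
      have "cmod ((?w' - ?c * ?w) - \<zeta> i * (?z' - ?c * ?z)) \<le> cmod (?w' - ?c * ?w) + cmod (\<zeta> i * (?z' - ?c * ?z))"
        by (rule norm_triangle_ineq4)
      also have "\<dots> \<le> A\<^sup>2 * e\<^sup>2 * (cmod (\<zeta> i) * cmod ?z) + cmod (\<zeta> i) * (A\<^sup>2 * e\<^sup>2 * cmod ?z)"
        using bw bz unfolding \<open>?w = \<zeta> i * ?z\<close> norm_mult by (intro add_mono mult_left_mono) auto
      also have "\<dots> = 2 * A\<^sup>2 * e\<^sup>2 * cmod (\<zeta> i) * cmod ?z" by (simp add: algebra_simps)
      also have "\<dots> \<le> 2 * A\<^sup>2 * e\<^sup>2 * Zm * (4 * cmod ?z')"
      proof (intro mult_mono mult_nonneg_nonneg)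
        show "cmod (\<zeta> i) \<le> Zm" using ball[OF i near[OF i]] Zm(2)[OF iI] by (simp add: \<zeta>_def)
        show "cmod ?z \<le> 4 * cmod ?z'" using lower by simp
      qed (use Zm in auto)
      finally have "cmod (amplitude_ratio (\<omega> i) (\<psi> i) q (N + l) - amplitude_ratio (\<omega> i) (\<psi> i) q N)
          \<le> 8 * A\<^sup>2 * e\<^sup>2 * Zm"
        unfolding num norm_divide using z0 by (simp add: field_simps)
      also have "\<dots> \<le> 8 * A\<^sup>2 * (2 * real l / (rmin * real N))\<^sup>2 * Zm"
      proof -
        have "e \<le> 2 * real l / (rmin * real N)"
          unfolding e_def \<epsilon>_def using rmin(1) Npos by (intro divide_left_mono mult_left_mono mult_pos_pos) auto
        then have "e\<^sup>2 \<le> (2 * real l / (rmin * real N))\<^sup>2" using e0 by (intro power_mono) auto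
        then show ?thesis using Zm(1) by (intro mult_right_mono mult_left_mono) auto
      qed
      also have "\<dots> = 32 * A\<^sup>2 * (real l)\<^sup>2 * Zm / rmin\<^sup>2 / (real N)\<^sup>2"
        by (simp add: power_divide power_mult_distrib)
      also have "\<dots> \<le> 1 / sqrt (real N) - 1 / sqrt (real (N + 1))" using N0(2) N(1) by blast
      also have "\<dots> \<le> 1 / sqrt (real N) - 1 / sqrt (real (N + l))"
        using l(1) by (intro diff_left_mono divide_left_mono mult_pos_pos) auto
      finally show ?thesis by simp
    qed
    show ?thesis using c1 c2 bound drift by (intro exI[of _ q]) (auto simp: q_def)
  qed
  show ?thesis
    by (rule exI[of _ l], rule exI[of _ N\<^sub>0]) (use l main in blast)
qed

section \<open>Concatenating the blocks\<close>

text \<open>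
  After the first site the two amplitudes are \<open>\<i> * (cnj (\<psi> 0) - t * cnj (\<psi> 1))\<close> and
  \<open>\<i> * (cnj (\<psi> 0) + t * cnj (\<psi> 1))\<close> with a small \<open>t > 0\<close>, and the sign of \<open>Im \<zeta>\<close> is opposite to that of the Wronskian.
\<close>

lemma kick_ratio:
  fixes \<kappa> :: real
  assumes i: "i \<in> E" and \<kappa>: "\<kappa> > 0"
    and small: "\<kappa> * \<bar>Im (cnj (\<psi> i 0) * \<psi> i 1)\<bar> * cmod (\<psi> i 1) < \<bar>\<omega> i\<bar> * cmod (\<psi> i 0)"
    and q: "q 1 = \<kappa>"
  defines "\<zeta> \<equiv> amplitude_ratio (\<omega> i) (\<psi> i) q 1"
  shows "Re \<zeta> > 0" and "\<omega> i * Im \<zeta> < 0"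
proof -
  define y where "y = Im (cnj (\<psi> i 0) * \<psi> i 1)"
  have wy: "\<omega> i * y > 0" using wronskian[OF i, of 0] by (simp add: y_def)
  have om: "\<omega> i \<noteq> 0" by (rule nonzero(2)[OF i])
  define t where "t = \<kappa> * y / \<omega> i"
  have t: "t > 0" 
  proof -
    have "t = \<kappa> * (\<omega> i * y) / (\<omega> i)\<^sup>2" using om by (simp add: t_def power2_eq_square)
    then show ?thesis using wy \<kappa> om by simp
  qed
  have p0: "\<psi> i 0 \<noteq> 0" by (rule nonzero(1)[OF i])
  have re: "Re (\<i> * cnj (\<psi> i 0) * \<psi> i (Suc 0)) = - y" by (simp add: y_def algebra_simps)
  have z: "amplitude (\<omega> i) (\<psi> i) q 1 = \<i> * (cnj (\<psi> i 0) - of_real t * cnj (\<psi> i 1))"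
    unfolding One_nat_def amplitude.simps re using q by (simp add: t_def algebra_simps)
  have w: "amplitude (- \<omega> i) (\<psi> i) q 1 = \<i> * (cnj (\<psi> i 0) + of_real t * cnj (\<psi> i 1))"
    unfolding One_nat_def amplitude.simps re using q by (simp add: t_def algebra_simps)
  define D where "D = cnj (\<psi> i 0) - of_real t * cnj (\<psi> i 1)"
  have "D \<noteq> 0" using amplitude_nonzero[of "\<psi> i" "\<omega> i" q 1] p0 z by (auto simp: D_def)
  have z': "\<zeta> = (cnj (\<psi> i 0) + of_real t * cnj (\<psi> i 1)) * cnj D / of_real ((cmod D)\<^sup>2)"
  proof -
    have "\<zeta> = (cnj (\<psi> i 0) + of_real t * cnj (\<psi> i 1)) / D"
      unfolding \<zeta>_def amplitude_ratio_def z w D_def by simp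
    also have "\<dots> = (cnj (\<psi> i 0) + of_real t * cnj (\<psi> i 1)) * cnj D / (D * cnj D)"
      using \<open>D \<noteq> 0\<close> by simp
    finally show ?thesis by (simp only: complex_norm_square)
  qed
  have rr: "Re ((cnj (\<psi> i 0) + of_real t * cnj (\<psi> i 1)) * cnj D) = (cmod (\<psi> i 0))\<^sup>2 - (t * cmod (\<psi> i 1))\<^sup>2"
    unfolding D_def power_mult_distrib cmod_power2 by (simp add: power2_eq_square algebra_simps)
  have ii: "Im ((cnj (\<psi> i 0) + of_real t * cnj (\<psi> i 1)) * cnj D) = - (2 * t * y)"
    unfolding D_def y_def by (simp add: algebra_simps)
  have pos: "(cmod D)\<^sup>2 > 0" using \<open>D \<noteq> 0\<close> by simp
  have "t * cmod (\<psi> i 1) < cmod (\<psi> i 0)"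
  proof -
    have "t = \<kappa> * \<bar>y\<bar> / \<bar>\<omega> i\<bar>" using t \<kappa> by (metis abs_divide abs_mult abs_of_pos t_def)
    then have "\<bar>\<omega> i\<bar> * (t * cmod (\<psi> i 1)) < \<bar>\<omega> i\<bar> * cmod (\<psi> i 0)"
      using small om by (simp add: y_def del: times_complex.sel)
    then show ?thesis using om by (simp add: mult_less_cancel_left)
  qed
  then have "(t * cmod (\<psi> i 1))\<^sup>2 < (cmod (\<psi> i 0))\<^sup>2" using t by (intro power_strict_mono) auto
  then show "Re \<zeta> > 0" unfolding z' Re_divide_of_real rr using pos by simp
  have "\<omega> i * Im \<zeta> = - (2 * t * (\<omega> i * y)) / (cmod D)\<^sup>2" unfolding z' Im_divide_of_real ii by simp
  then show "\<omega> i * Im \<zeta> < 0" using t wy pos by (simp add: divide_neg_pos)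
qed

text \<open>
  Stage \<open>s\<close> treats the energies with index at most \<open>s\<close>, and always those in \<open>P\<close>. A block that starts at \<open>N\<close> uses
  the largest stage whose threshold has been passed, so every energy is treated from some block on.
\<close>

theorem decaying_potential_exists:
  assumes P: "finite P" "P \<subseteq> E"
    and K: "filterlim K at_top sequentially" and Kpos: "\<And>n. n \<ge> 1 \<Longrightarrow> K n > 0"
  shows "\<exists>q. (\<forall>n\<ge>1. \<bar>q n\<bar> \<le> K n / real n) \<and>
     (\<forall>i\<in>E. \<exists>C. \<forall>n. real n * cmod (amplitude (\<omega> i) (\<psi> i) q n) \<le> C) \<and>
     (\<forall>i\<in>P. \<exists>C. \<forall>n. real n * cmod (amplitude (- \<omega> i) (\<psi> i) q n) \<le> C)"
proof -
  \<comment> \<open>The kick is small enough for \<open>kick_ratio\<close> to apply to every \<open>i\<close> in \<open>P\<close>.\<close>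
  define \<kappa>max where "\<kappa>max i = \<bar>\<omega> i\<bar> * cmod (\<psi> i 0) / (\<bar>Im (cnj (\<psi> i 0) * \<psi> i 1)\<bar> * cmod (\<psi> i 1))" for i
  have "\<kappa>max i > 0" if "i \<in> P" for i
  proof -
    have "i \<in> E" using that P by auto
    then have "Im (cnj (\<psi> i 0) * \<psi> i 1) \<noteq> 0" using wronskian[of i 0] by auto
    then show ?thesis using nonzero[OF \<open>i \<in> E\<close>] unfolding \<kappa>max_def
      by (intro divide_pos_pos mult_pos_pos) (auto simp del: times_complex.sel)
  qed
  then obtain c where c: "c > 0" "\<And>i. i \<in> P \<Longrightarrow> c \<le> \<kappa>max i"
    using finite_common_lower_bound[of P \<kappa>max] P(1) by blast
  define \<kappa> where "\<kappa> = min (K 1) (c / 2)"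
  have \<kappa>: "\<kappa> > 0" "\<kappa> \<le> K 1" "\<kappa> < c" using Kpos[of 1] c(1) by (auto simp: \<kappa>_def)
  define q\<^sub>1 where "q\<^sub>1 n = (if n = 1 then \<kappa> else 0)" for n :: nat
  define \<zeta>\<^sub>0 where "\<zeta>\<^sub>0 i = amplitude_ratio (\<omega> i) (\<psi> i) q\<^sub>1 1" for i
  have \<zeta>0: "Re (\<zeta>\<^sub>0 i) > 0 \<and> \<omega> i * Im (\<zeta>\<^sub>0 i) < 0" if i: "i \<in> P" for i
  proof -
    have iE: "i \<in> E" using i P by auto
    have y: "\<bar>Im (cnj (\<psi> i 0) * \<psi> i 1)\<bar> * cmod (\<psi> i 1) > 0"
      using wronskian[OF iE, of 0] nonzero(1)[OF iE, of 1] by (auto intro!: mult_pos_pos simp del: times_complex.sel)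
    have "\<kappa> < \<bar>\<omega> i\<bar> * cmod (\<psi> i 0) / (\<bar>Im (cnj (\<psi> i 0) * \<psi> i 1)\<bar> * cmod (\<psi> i 1))"
      using c(2)[OF i] \<kappa>(3) unfolding \<kappa>max_def by linarith
    then have "\<kappa> * \<bar>Im (cnj (\<psi> i 0) * \<psi> i 1)\<bar> * cmod (\<psi> i 1) < \<bar>\<omega> i\<bar> * cmod (\<psi> i 0)"
      unfolding pos_less_divide_eq[OF y] by (simp only: mult.assoc)
    from kick_ratio[OF iE \<kappa>(1) this, of q\<^sub>1] show ?thesis by (simp add: \<zeta>\<^sub>0_def q\<^sub>1_def)
  qed
  have "0 < min (Re (\<zeta>\<^sub>0 i) / 2) (\<bar>Im (\<zeta>\<^sub>0 i)\<bar> / 2)" if "i \<in> P" for i using \<zeta>0[OF that] by auto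
  then obtain \<rho> where \<rho>: "\<rho> > 0" "\<And>i. i \<in> P \<Longrightarrow> \<rho> \<le> min (Re (\<zeta>\<^sub>0 i) / 2) (\<bar>Im (\<zeta>\<^sub>0 i)\<bar> / 2)"
    using finite_common_lower_bound[of P "\<lambda>i. min (Re (\<zeta>\<^sub>0 i) / 2) (\<bar>Im (\<zeta>\<^sub>0 i)\<bar> / 2)"] P(1) by blast
  have cone: "2 * \<rho> \<le> Re (\<zeta>\<^sub>0 i) \<and> 2 * \<rho> \<le> \<bar>Im (\<zeta>\<^sub>0 i)\<bar> \<and> \<omega> i * Im (\<zeta>\<^sub>0 i) < 0" if "i \<in> P" for i
    using \<rho>(2)[OF that] \<zeta>0[OF that] by auto
  define I where "I s = {i \<in> E. i \<le> s} \<union> P" for s :: nat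
  define ratio where "ratio i = amplitude_ratio (\<omega> i) (\<psi> i)" for i
  define good where "good s l N q\<^sub>0 q \<longleftrightarrow> (\<forall>n\<le>N. q n = q\<^sub>0 n) \<and> (\<forall>n\<in>{N<..N+l}. \<bar>q n\<bar> \<le> K n / real n) \<and>
        (\<forall>i\<in>I s. contracts (\<omega> i) (\<psi> i) q N l) \<and> (\<forall>i\<in>P. contracts (- \<omega> i) (\<psi> i) q N l) \<and>
        (\<forall>i\<in>P. cmod (ratio i q (N + l) - ratio i q N) \<le> 1 / sqrt N - 1 / sqrt (N + l))"
    for s l N :: nat and q\<^sub>0 q :: "nat \<Rightarrow> real"
  define ok where "ok s l N\<^sub>0 \<longleftrightarrow> l > 0 \<and> T dvd l \<and> (\<forall>N q\<^sub>0. N \<ge> N\<^sub>0 \<and> T dvd N \<and>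
     (\<forall>i\<in>P. cmod (ratio i q\<^sub>0 N - \<zeta>\<^sub>0 i) \<le> \<rho>) \<longrightarrow> (\<exists>q. good s l N q\<^sub>0 q))" for s l N\<^sub>0
  have "\<exists>l N\<^sub>0. ok s l N\<^sub>0" for s
    unfolding ok_def good_def ratio_def
    by (rule block_controls_exist[OF _ _ _ \<rho>(1) cone K]) (use P in \<open>auto simp: I_def\<close>)
  then obtain L N\<^sub>0 where ok: "\<And>s. ok s (L s) (N\<^sub>0 s)" by metis
  \<comment> \<open>Blocks not longer than \<open>N\<close> at most double \<open>n\<close>, as \<open>contracting_blocks_decay\<close> requires.\<close>
  define thr where "thr s = max (N\<^sub>0 s) (L s)" for s
  define stage where "stage N = Max {s. s \<le> N \<and> thr s \<le> N}" for N
  have stage: "thr (stage N) \<le> N" if "N \<ge> thr 0" for N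
  proof -
    have "stage N \<in> {s. s \<le> N \<and> thr s \<le> N}" unfolding stage_def using that by (intro Max_in) auto
    then show ?thesis by simp
  qed
  have stage_ge: "s \<le> stage N" if "s \<le> N" "thr s \<le> N" for s N
    unfolding stage_def using that by (intro Max_ge) auto
  obtain M where M: "real M \<ge> 1 / \<rho>\<^sup>2" using real_arch_simple by blast
  \<comment> \<open>The potential is zero between the kick and \<open>Ni\<close>; from there on the drift of \<open>\<zeta>\<close> adds up to at most \<open>\<rho>\<close>.\<close>
  define Ni where "Ni = T * (thr 0 + M + 1)"
  have Ni: "Ni \<ge> thr 0 + M + 1" using mult_le_mono1[OF T_pos, of "thr 0 + M + 1"] by (simp add: Ni_def)
  have sNi: "1 / sqrt Ni \<le> \<rho>"
  proof -
    have "1 / \<rho>\<^sup>2 \<le> real Ni" using M Ni by linarith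
    then have "sqrt (1 / \<rho>\<^sup>2) \<le> sqrt (real Ni)" by (rule real_sqrt_le_mono)
    then have "1 / \<rho> \<le> sqrt (real Ni)" using \<rho>(1) by (simp add: real_sqrt_divide)
    moreover have "sqrt (real Ni) > 0" using Ni by simp
    ultimately show ?thesis using \<rho>(1) by (simp add: field_simps)
  qed
  define inv where "inv p \<longleftrightarrow> T dvd fst p \<and> fst p \<ge> Ni \<and> (\<forall>n. 1 \<le> n \<and> n \<le> fst p \<longrightarrow> \<bar>snd p n\<bar> \<le> K n / real n) \<and>
     (\<forall>i\<in>P. cmod (ratio i (snd p) (fst p) - \<zeta>\<^sub>0 i) \<le> 1 / sqrt Ni - 1 / sqrt (fst p))" for p :: "nat \<times> (nat \<Rightarrow> real)"
  define next_to where "next_to p p' \<longleftrightarrow> fst p' = fst p + L (stage (fst p)) \<and>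
     good (stage (fst p)) (L (stage (fst p))) (fst p) (snd p) (snd p')" for p p' :: "nat \<times> (nat \<Rightarrow> real)"
  have start: "\<exists>p. inv p"
  proof
    have "amplitude om \<phi> q\<^sub>1 Ni = amplitude om \<phi> q\<^sub>1 1" for om \<phi>
      using Ni by (intro amplitude_unperturbed) (auto simp: q\<^sub>1_def)
    then show "inv (Ni, q\<^sub>1)"
      using \<kappa> Kpos by (auto simp: inv_def ratio_def \<zeta>\<^sub>0_def amplitude_ratio_def q\<^sub>1_def Ni_def less_imp_le)
  qed
  have continue: "\<exists>p'. inv p' \<and> next_to p p'" if p: "inv p" for p
  proof -
    obtain N q where pq: "p = (N, q)" by (cases p)
    define s where "s = stage N"
    have N: "T dvd N" "N \<ge> Ni" "\<And>n. 1 \<le> n \<Longrightarrow> n \<le> N \<Longrightarrow> \<bar>q n\<bar> \<le> K n / real n"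
      "\<And>i. i \<in> P \<Longrightarrow> cmod (ratio i q N - \<zeta>\<^sub>0 i) \<le> 1 / sqrt Ni - 1 / sqrt N"
      using p by (auto simp: inv_def pq)
    have "thr s \<le> N" unfolding s_def using stage[of N] N(2) Ni by linarith
    then have "N\<^sub>0 s \<le> N" by (simp add: thr_def)
    moreover have "cmod (ratio i q N - \<zeta>\<^sub>0 i) \<le> \<rho>" if "i \<in> P" for i
      using N(4)[OF that] sNi by (smt (verit) divide_nonneg_nonneg of_nat_0_le_iff real_sqrt_ge_zero)
    ultimately obtain q' where q': "good s (L s) N q q'"
      using ok[of s] N(1) unfolding ok_def by blast
    have eq: "q' n = q n" if "n \<le> N" for n using q' that by (simp add: good_def)
    have "inv (N + L s, q')"
      unfolding inv_def fst_conv snd_conv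
    proof (intro conjI allI ballI impI)
      show "T dvd N + L s" using N(1) ok[of s] by (simp add: ok_def)
      show "Ni \<le> N + L s" using N(2) by simp
      show "\<bar>q' n\<bar> \<le> K n / real n" if "1 \<le> n \<and> n \<le> N + L s" for n
      proof (cases "n \<le> N")
        case True
        then show ?thesis using eq N(3) that by simp
      next
        case False
        then show ?thesis using q' that by (simp add: good_def)
      qed
      fix i assume i: "i \<in> P"
      have "amplitude om \<phi> q' N = amplitude om \<phi> q N" for om \<phi> by (rule amplitude_cong) (simp add: eq)
      then have "ratio i q' N = ratio i q N" by (simp add: ratio_def amplitude_ratio_def)
      moreover have "cmod (ratio i q' (N + L s) - ratio i q' N) \<le> 1 / sqrt N - 1 / sqrt (N + L s)"
        using q' i by (simp add: good_def)
      moreover have "cmod (ratio i q' (N + L s) - \<zeta>\<^sub>0 i) \<le> cmod (ratio i q' (N + L s) - ratio i q' N) + cmod (ratio i q' N - \<zeta>\<^sub>0 i)"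
        using norm_triangle_ineq[of "ratio i q' (N + L s) - ratio i q' N" "ratio i q' N - \<zeta>\<^sub>0 i"] by simp
      ultimately show "cmod (ratio i q' (N + L s) - \<zeta>\<^sub>0 i) \<le> 1 / sqrt Ni - 1 / sqrt (N + L s)"
        using N(4)[OF i] by simp
    qed
    moreover have "next_to p (N + L s, q')" using q' by (simp add: next_to_def pq s_def)
    ultimately show ?thesis by blast
  qed
  have "\<exists>f. \<forall>k. inv (f k) \<and> next_to (f k) (f (Suc k))"
    using dependent_nat_choice[of "\<lambda>_. inv" "\<lambda>_. next_to"] start continue by blast
  then obtain f where f: "\<And>k. inv (f k)" "\<And>k. next_to (f k) (f (Suc k))" by blast
  define Nn where "Nn k = fst (f k)" for k
  define l where "l k = L (stage (Nn k))" for k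
  define qq where "qq k = snd (f k)" for k
  have Nstep: "Nn (Suc k) = Nn k + l k" for k using f(2)[of k] by (simp add: next_to_def Nn_def l_def)
  have lpos: "l k > 0" for k using ok[of "stage (Nn k)"] by (simp add: ok_def l_def)
  have NNi: "Nn k \<ge> Ni" for k using f(1)[of k] by (simp add: inv_def Nn_def)
  have lshort: "l k \<le> Nn k" for k 
  proof -
    have "thr (stage (Nn k)) \<le> Nn k" using stage[of "Nn k"] NNi[of k] Ni by linarith
    then show ?thesis by (simp add: thr_def l_def)
  qed
  have good: "good (stage (Nn k)) (l k) (Nn k) (qq k) (qq (Suc k))" for k
    using f(2)[of k] by (simp add: next_to_def Nn_def l_def qq_def)
  have mono: "strict_mono Nn" by (rule strict_monoI_Suc) (simp add: Nstep lpos)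
  have Nge: "k \<le> Nn k" for k by (rule strict_mono_imp_increasing[OF mono])
  have agree: "qq k' n = qq k n" if "k \<le> k'" "n \<le> Nn k" for k k' n
    using that(1)
  proof (induction k' rule: dec_induct)
    case (step m)
    have "n \<le> Nn m" using that(2) strict_mono_leD[OF mono step(1)] by linarith
    then have "qq (Suc m) n = qq m n" using good[of m] by (simp add: good_def)
    then show ?case using step by simp
  qed simp
  \<comment> \<open>Since \<open>n\<close> is at most \<open>Nn n\<close>, the value at \<open>n\<close> is settled by the \<open>n\<close>-th approximation.\<close>
  define q where "q n = qq n n" for n
  have q: "q n = qq k n" if "n \<le> Nn k" for n k
  proof (cases "k \<le> n")
    case True
    then show ?thesis using agree[of k n n] that by (simp add: q_def)
  next
    case False
    then show ?thesis using agree[of n k n] Nge[of n] by (simp add: q_def)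
  qed
  have bound: "\<bar>q n\<bar> \<le> K n / real n" if "n \<ge> 1" for n
    using f(1)[of n] that Nge[of n] by (simp add: inv_def q_def qq_def Nn_def)
  have contr: "contracts om \<phi> q (Nn k) (l k) \<longleftrightarrow> contracts om \<phi> (qq (Suc k)) (Nn k) (l k)" for om \<phi> k
    by (rule contracts_cong) (simp add: q[of _ "Suc k"] Nstep)
  have "\<exists>C. \<forall>n. real n * cmod (amplitude (- \<omega> i) (\<psi> i) q n) \<le> C" if "i \<in> P" for i
    by (rule contracting_blocks_decay[where Nn = Nn and l = l, OF Nstep lpos lshort, where k\<^sub>0 = 0])
      (use good that in \<open>auto simp: contr good_def\<close>)
  moreover have "\<exists>C. \<forall>n. real n * cmod (amplitude (\<omega> i) (\<psi> i) q n) \<le> C" if "i \<in> E" for i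
  proof (rule contracting_blocks_decay[where Nn = Nn and l = l, OF Nstep lpos lshort, where k\<^sub>0 = "max i (thr i)"])
    fix k assume "k \<ge> max i (thr i)"
    then have "i \<le> stage (Nn k)" using Nge[of k] by (intro stage_ge) auto
    then have "i \<in> I (stage (Nn k))" using that by (simp add: I_def)
    then show "contracts (\<omega> i) (\<psi> i) q (Nn k) (l k)" using good[of k] by (simp add: contr good_def)
  qed
  ultimately show ?thesis using bound by blast
qed

end

section \<open>Quasi-momenta and the proof of the theorem\<close>

lemma cos_double_eq_iff:
  assumes "0 < s" "s < pi" "0 < t" "t < pi"
  shows "cos (2 * s) = cos (2 * t) \<longleftrightarrow> s = t \<or> s = pi - t"
proof
  assume "cos (2 * s) = cos (2 * t)"
  then have "(cos s)\<^sup>2 = (cos t)\<^sup>2" by (simp add: cos_double_cos)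
  then consider "cos s = cos t" | "cos s = cos (pi - t)" by (auto simp: power2_eq_iff cos_pi_minus)
  then show "s = t \<or> s = pi - t"
    by cases (use assms cos_inj_pi[of s t] cos_inj_pi[of s "pi - t"] in auto)
next
  assume "s = t \<or> s = pi - t"
  then show "cos (2 * s) = cos (2 * t)"
    by (auto simp: cos_double_cos cos_pi_minus)
qed

interpretation rat_real: module "\<lambda>(r::rat) (x::real). of_rat r * x"
  by unfold_locales (simp_all add: of_rat_add of_rat_mult algebra_simps)

lemma rationally_independent_relation:
  assumes "rationally_independent xs" and "S \<subseteq> set xs" and "finite S"
    and "(\<Sum>v\<in>S. of_rat (u v) * v) = 0" and "v \<in> S"
  shows "u v = 0"
proof -
  have "rat_real.independent (set xs)" using assms(1) by (simp add: rationally_independent_def)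
  then show ?thesis using rat_real.independentD[of "set xs" S u v] assms by simp
qed

theorem theorem4p6:
  fixes T :: nat and a b :: "nat \<Rightarrow> real" and lam :: "nat \<Rightarrow> real" and K :: "nat \<Rightarrow> real"
  assumes "periodic_coeffs T a b"
    and "\<forall>i\<ge>3. lam i \<in> sigma_ell T a b"
    and "\<forall>n\<ge>3. rationally_independent (pi # map (\<lambda>i. quasi_momentum T a b (lam i)) [3..<n + 1])"
    and "lam 1 \<in> sigma_ell T a b" and "lam 2 \<in> sigma_ell T a b"
    and "0 < quasi_momentum T a b (lam 1)" and "quasi_momentum T a b (lam 1) < pi / 2"
    and "pi / 2 < quasi_momentum T a b (lam 2)" and "quasi_momentum T a b (lam 2) < pi"
    and "quasi_momentum T a b (lam 1) \<noteq> pi - quasi_momentum T a b (lam 2)"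
    and "\<forall>n\<ge>1. K n > 0" and "filterlim K at_top sequentially"
  shows "\<exists>(q :: nat \<Rightarrow> real) (u :: nat \<Rightarrow> nat \<Rightarrow> real).
           q \<longlonglongrightarrow> 0 \<and> (\<forall>n\<ge>1. \<bar>q n\<bar> \<le> K n / real n) \<and>
           (\<forall>i\<ge>1. u i \<in> l2_real \<and> u i \<noteq> (\<lambda>n. 0) \<and>
              (\<lambda>n. jacobi_op a b (u i) n + diag_op q (u i) n) = (\<lambda>n. lam i * u i n))"
proof -
  note per = assms(1)
  have T: "T \<ge> 1" using per by (simp add: periodic_coeffs_def)
  define \<theta> where "\<theta> i = quasi_momentum T a b (lam i)" for i
  have ell: "lam i \<in> sigma_ell T a b" if "i \<ge> 1" for i
  proof -
    have "i = 1 \<or> i = 2 \<or> i \<ge> 3" using that by linarith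
    then show ?thesis using assms(2,4,5) by auto
  qed
  have th: "0 < \<theta> i" "\<theta> i < pi" if "i \<ge> 1" for i
    using quasi_momentum[OF per ell[OF that]] by (simp_all add: \<theta>_def)
  have ind: "rationally_independent (pi # map \<theta> [3..<n + 1])" if "n \<ge> 3" for n
    using assms(3) that unfolding \<theta>_def by blast
  \<comment> \<open>Otherwise \<open>\<tau>\<^sup>2\<close> would be \<open>- 1\<close>, and \<open>F\<close> and its conjugate could not be told apart.\<close>
  have not_half: "\<theta> i \<noteq> pi / 2" if "i \<ge> 1" for i
  proof (cases "i \<ge> 3")
    case True
    show ?thesis
    proof
      assume "\<theta> i = pi / 2"
      moreover have "pi \<noteq> \<theta> i" "\<theta> i \<noteq> pi" using th[OF that] by auto
      ultimately have "(\<Sum>v\<in>{pi, \<theta> i}. of_rat (if v = pi then 1 else - 2) * v) = 0" by simp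
      from rationally_independent_relation[OF ind[OF True] _ _ this, of pi] True show False by auto
    qed
  next
    case False
    then have "i = 1 \<or> i = 2" using that by linarith
    then show ?thesis using assms(7,8) by (auto simp: \<theta>_def)
  qed
  have noneq_late: "cos (2 * \<theta> i) \<noteq> cos (2 * \<theta> j)" if "3 \<le> i" "i < j" for i j
  proof
    assume "cos (2 * \<theta> i) = cos (2 * \<theta> j)"
    then have or: "\<theta> i = \<theta> j \<or> \<theta> i = pi - \<theta> j"
      using cos_double_eq_iff[of "\<theta> i" "\<theta> j"] th[of i] th[of j] that by simp
    have j3: "j \<ge> 3" using that by linarith
    have "distinct (map \<theta> [3..<j + 1])"
      using ind[OF j3] unfolding rationally_independent_def distinct.simps by blast
    then have inj: "inj_on \<theta> {3..<j + 1}" unfolding distinct_map set_upt by blast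
    have ne: "\<theta> i \<noteq> \<theta> j" using inj_onD[OF inj, of i j] that by auto
    have "\<theta> i = pi - \<theta> j" using ne or by simp
    moreover have "pi \<noteq> \<theta> i" "pi \<noteq> \<theta> j" using th[of i] th[of j] that by auto
    ultimately have "(\<Sum>v\<in>{pi, \<theta> i, \<theta> j}. of_rat (if v = pi then 1 else - 1) * v) = 0"
      using ne that \<open>pi \<noteq> \<theta> i\<close> \<open>pi \<noteq> \<theta> j\<close> by simp
    from rationally_independent_relation[OF ind[OF j3] _ _ this, of pi] that j3 show False by auto
  qed
  have noneq_12: "cos (2 * \<theta> 1) \<noteq> cos (2 * \<theta> 2)"
    using cos_double_eq_iff[of "\<theta> 1" "\<theta> 2"] th[of 1] th[of 2] assms(7,8,10) by (auto simp: \<theta>_def)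
  have resonance: "(i \<le> 2 \<and> j \<ge> 3) \<or> (j \<le> 2 \<and> i \<ge> 3)"
    if "i \<ge> 1" "j \<ge> 1" "i \<noteq> j" "cos (2 * \<theta> i) = cos (2 * \<theta> j)" for i j
  proof (rule ccontr)
    assume "\<not> ?thesis"
    then have "i = 1 \<and> j = 2 \<or> i = 2 \<and> j = 1 \<or> 3 \<le> i \<and> i < j \<or> 3 \<le> j \<and> j < i"
      using that(1-3) by presburger
    then show False
      using noneq_12 noneq_late[of i j] noneq_late[of j i] that(4) by auto
  qed
  have "\<exists>\<psi> \<omega> \<tau>. floquet T a b (lam i) \<psi> \<omega> \<tau> \<and> Im (\<tau>\<^sup>2) > 0 \<and> Re (\<tau>\<^sup>2) = cos (2 * \<theta> i)" if "i \<ge> 1" for i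
    using floquet_exists[OF per ell[OF that]] not_half[OF that] by (simp add: \<theta>_def)
  then obtain \<psi> \<omega> \<tau> where fl: "\<And>i. i \<ge> 1 \<Longrightarrow> floquet T a b (lam i) (\<psi> i) (\<omega> i) (\<tau> i)"
    and up: "\<And>i. i \<ge> 1 \<Longrightarrow> Im ((\<tau> i)\<^sup>2) > 0" and re: "\<And>i. i \<ge> 1 \<Longrightarrow> Re ((\<tau> i)\<^sup>2) = cos (2 * \<theta> i)"
    by metis
  define chiral where "chiral x y \<longleftrightarrow> (\<forall>n\<ge>1. 2 * b n = x + y)" for x y
  \<comment> \<open>Energies outside \<open>E\<close> repeat \<open>lam 1\<close> or \<open>lam 2\<close> or are their mirror images; they are served by the
    amplitudes of these two for \<open>\<omega>\<close> and \<open>- \<omega>\<close>.\<close>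
  define E where "E = {1, 2} \<union> {i. i \<ge> 3 \<and> lam i \<noteq> lam 1 \<and> lam i \<noteq> lam 2 \<and>
      \<not> chiral (lam 1) (lam i) \<and> \<not> chiral (lam 2) (lam i)}"
  have E1: "i \<ge> 1" if "i \<in> E" for i using that by (auto simp: E_def)
  have cosE: "cos (2 * \<theta> i) = cos (2 * \<theta> j)" if "i \<ge> 1" "j \<ge> 1" "(\<tau> j)\<^sup>2 = (\<tau> i)\<^sup>2" for i j
    using re[OF that(1)] re[OF that(2)] that(3) by simp
  interpret floquet_family T E \<psi> \<omega> \<tau>
  proof
    show "1 \<le> T" by (rule T)
  next
    fix i n assume "i \<in> E"
    note fli = fl[OF E1[OF this]]
    show "\<psi> i (n + T) = \<tau> i * \<psi> i n" "cmod (\<tau> i) = 1" using fli by (simp_all add: floquet_def)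
    show "0 < Im ((\<tau> i)\<^sup>2)" by (rule up[OF E1[OF \<open>i \<in> E\<close>]])
    have "weight0 T a n * Im (cnj (\<psi> i n) * \<psi> i (Suc n)) = \<omega> i"
      using fli unfolding floquet_def by blast
    then have "\<omega> i * Im (cnj (\<psi> i n) * \<psi> i (Suc n)) = weight0 T a n * (Im (cnj (\<psi> i n) * \<psi> i (Suc n)))\<^sup>2"
      by (metis mult.assoc power2_eq_square)
    also have "\<dots> > 0" using weight0_pos[OF per] floquet_wronskian_nonzero[OF fli, of n]
      by (intro mult_pos_pos) (simp_all del: times_complex.sel)
    finally show "0 < \<omega> i * Im (cnj (\<psi> i n) * \<psi> i (Suc n))" .
  next
    fix i j k assume E: "i \<in> E" "j \<in> E" "k \<in> E" and t: "(\<tau> j)\<^sup>2 = (\<tau> i)\<^sup>2" "(\<tau> k)\<^sup>2 = (\<tau> i)\<^sup>2"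
      and ne: "j \<noteq> i" "k \<noteq> i"
    show "j = k"
    proof (rule ccontr)
      assume "j \<noteq> k"
      note E1 = E1[OF E(1)] E1[OF E(2)] E1[OF E(3)]
      have "cos (2 * \<theta> i) = cos (2 * \<theta> j)" "cos (2 * \<theta> i) = cos (2 * \<theta> k)" "cos (2 * \<theta> j) = cos (2 * \<theta> k)"
        using cosE[OF E1(1,2)] cosE[OF E1(1,3)] cosE[OF E1(2,3)] t by auto
      then show False
        using resonance[OF E1(1,2)] resonance[OF E1(1,3)] resonance[OF E1(2,3)] ne \<open>j \<noteq> k\<close> by linarith
    qed
  next
    fix i j assume E: "i \<in> E" "j \<in> E" and ne: "i \<noteq> j" and t: "(\<tau> j)\<^sup>2 = (\<tau> i)\<^sup>2"
    have sep: "lam i \<noteq> lam j" "\<not> chiral (lam i) (lam j)"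
    proof -
      have "(i = 1 \<or> i = 2) \<and> j \<ge> 3 \<or> (j = 1 \<or> j = 2) \<and> i \<ge> 3"
        using resonance[OF E1[OF E(1)] E1[OF E(2)] ne cosE[OF E1[OF E(1)] E1[OF E(2)] t]] E1[OF E(1)] E1[OF E(2)]
        by presburger
      then have "lam i \<noteq> lam j \<and> \<not> chiral (lam i) (lam j)"
        using E by (auto simp: E_def chiral_def add.commute)
      then show "lam i \<noteq> lam j" "\<not> chiral (lam i) (lam j)" by auto
    qed
    show "\<exists>m\<ge>1. \<exists>n\<ge>1. (\<psi> i m)\<^sup>2 * (\<psi> j n)\<^sup>2 \<noteq> (\<psi> i n)\<^sup>2 * (\<psi> j m)\<^sup>2"
      by (rule floquet_squares_independent[OF per fl[OF E1[OF E(1)]] fl[OF E1[OF E(2)]] sep(1)])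
        (use sep(2) in \<open>simp add: chiral_def\<close>)
  qed
  \<comment> \<open>With the square root, \<open>K' n / n\<close> tends to zero even if \<open>K\<close> grows fast.\<close>
  define K' where "K' n = min (K n) (sqrt (real n))" for n
  have K'_lim: "filterlim K' at_top sequentially"
  proof -
    have "filterlim (\<lambda>n. sqrt (real n)) at_top sequentially" by real_asymp
    then show ?thesis
      using assms(12) unfolding filterlim_at_top K'_def min.bounded_iff
      by (auto simp: eventually_conj_iff)
  qed
  have K'_pos: "K' n > 0" if "n \<ge> 1" for n using assms(11) that by (simp add: K'_def)
  have "\<exists>q. (\<forall>n\<ge>1. \<bar>q n\<bar> \<le> K' n / real n) \<and>
     (\<forall>i\<in>E. \<exists>C. \<forall>n. real n * cmod (amplitude (\<omega> i) (\<psi> i) q n) \<le> C) \<and>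
     (\<forall>i\<in>{1, 2}. \<exists>C. \<forall>n. real n * cmod (amplitude (- \<omega> i) (\<psi> i) q n) \<le> C)"
    by (rule decaying_potential_exists[OF _ _ K'_lim K'_pos]) (auto simp: E_def)
  then obtain q where q: "\<And>n. n \<ge> 1 \<Longrightarrow> \<bar>q n\<bar> \<le> K' n / real n"
    and dec: "\<And>i. i \<in> E \<Longrightarrow> \<exists>C. \<forall>n. real n * cmod (amplitude (\<omega> i) (\<psi> i) q n) \<le> C"
    and dec': "\<And>i. i \<in> {1, 2} \<Longrightarrow> \<exists>C. \<forall>n. real n * cmod (amplitude (- \<omega> i) (\<psi> i) q n) \<le> C"
    by blast
  have q_lim: "q \<longlonglongrightarrow> 0"
  proof (rule Lim_null_comparison)
    show "\<forall>\<^sub>F n in sequentially. norm (q n) \<le> sqrt (real n) / real n"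
    proof (rule eventually_sequentiallyI[of 1])
      fix n :: nat assume n: "n \<ge> 1"
      have "K' n / real n \<le> sqrt (real n) / real n" by (intro divide_right_mono) (auto simp: K'_def)
      then show "norm (q n) \<le> sqrt (real n) / real n" using q[OF n] by simp
    qed
    show "(\<lambda>n. sqrt (real n) / real n) \<longlonglongrightarrow> 0" by real_asymp
  qed
  have q_bound: "\<bar>q n\<bar> \<le> K n / real n" if "n \<ge> 1" for n
  proof -
    have "K' n / real n \<le> K n / real n" by (intro divide_right_mono) (auto simp: K'_def)
    then show ?thesis using q[OF that] by linarith
  qed
  define eigen where "eigen x u \<longleftrightarrow> u \<in> l2_real \<and> u \<noteq> (\<lambda>n. 0) \<and>
      (\<lambda>n. jacobi_op a b u n + diag_op q u n) = (\<lambda>n. x * u n)" for x :: real and u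
  have direct: "\<exists>u. eigen (lam i) u" if iE: "i \<in> E" for i
  proof -
    obtain C where C: "\<And>n. real n * cmod (amplitude (\<omega> i) (\<psi> i) q n) \<le> C" using dec[OF iE] by blast
    show ?thesis unfolding eigen_def
      using perturbed_solution_eigenvector[OF per fl[OF E1[OF iE]] C] by blast
  qed
  have mirror: "\<exists>u. eigen y u" if i: "i \<in> {1, 2}" and y: "chiral (lam i) y" for i y
  proof -
    obtain C where C: "\<And>n. real n * cmod (amplitude (- \<omega> i) (\<psi> i) q n) \<le> C" using dec'[OF i] by blast
    have "i \<ge> 1" using i by auto
    have fl': "floquet T a b y (\<lambda>n. (-1) ^ n * \<psi> i n) (- \<omega> i) ((-1) ^ T * \<tau> i)"
      by (rule floquet_chiral[OF fl[OF \<open>i \<ge> 1\<close>]]) (use y in \<open>simp add: chiral_def\<close>)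
    show ?thesis unfolding eigen_def
      using perturbed_solution_eigenvector[OF per fl', of q C] C unfolding amplitude_chiral by blast
  qed
  have "\<exists>u. eigen (lam i) u" if "i \<ge> 1" for i
  proof (cases "i \<in> E")
    case False
    then have "i \<ge> 3" using that by (auto simp: E_def)
    then consider "lam i = lam 1" | "lam i = lam 2" | "chiral (lam 1) (lam i)" | "chiral (lam 2) (lam i)"
      using False by (auto simp: E_def)
    then show ?thesis
      by cases (use direct[of 1] direct[of 2] mirror[of 1 "lam i"] mirror[of 2 "lam i"] in \<open>auto simp: E_def\<close>)
  qed (rule direct)
  then obtain u where "\<And>i. i \<ge> 1 \<Longrightarrow> eigen (lam i) (u i)" by metis
  then show ?thesis using q_lim q_bound unfolding eigen_def by blast
qed

end
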